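(* Let $Z$ be a real-valued semimartingale on $(\Omega,\mathcal F,(\mathcal F_t)_{t\ge 0},P)$, let $(T_n)_{n\ge1}$ be a sequence of stopping times with disjoint graphs absorbing the jumps of $Z$, let $(W,H,\mu)$ be a Wiener space, and let $(e_n)_{n\ge1}$ be a complete orthonormal basis of the Cameron–Martin space $H$ constructed from elements of $W^\star$. For $t\ge 0$ put $$u_t(w,z)=\sum_{n:\,T_n(z)\le t}\Delta Z_{T_n}(z)\,\delta e_n(w)\,e_n ,\qquad U_t(w,z)=w+u_t(w,z),\qquad (w,z)\in W\times\Omega .$$ Then: 1. The mapping $U_t$, defined on $W\times\Omega$ with values in $W$, is a $\mu\times P$-almost surely well-defined perturbation of identity on the Wiener space $W$. 2. Besides, for $P$-almost all $z\in\Omega$, the partial map $w\mapsto u_t(w,z)$ is an $H$-$C^1$-map on $W$, i.e., the map $h\mapsto u_t(w+h,z)$ is a $C^1$-map on $H$ for all $w$ outside a set of capacity zero (this exceptional set can even be taken to be $H$-invariant).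
   Context: $(\Omega,\mathcal F,(\mathcal F_t)_{t\ge0},P)$ is a filtered probability space satisfying the usual conditions. $Z=(Z_t)_{t\ge0}$ is a real-valued semimartingale with jumps $\Delta Z_s=Z_s-Z_{s-}$; recall that $P$-almost surely $\sum_{s\le t}(\Delta Z_s)^2<\infty$ for all $t\ge0$. That $(T_n)_{n\ge1}$ absorbs the jumps of $Z$ means that $\{(s,z):\Delta Z_s(z)\ne0\}$ is contained in the union of the graphs of the $T_n$, these graphs being pairwise disjoint. $(W,H,\mu)$ is a Wiener space: $W$ is a Fréchet space, $\mu$ is the Gaussian (Wiener) measure on $W$, and $H$ is its Cameron–Martin space. $W^\star$ is the continuous dual of $W$, identified with a dense subset of $H$. $\delta e_n$ denotes the Gaussian divergence of $e_n\in H$; since $e_n\in W^\star$, $\delta e_n(w)=\langle e_n,w\rangle$ for every $w\in W$, so that $\delta e_n(w+h)=\delta e_n(w)+(e_n,h)_H$ for $h\in H$. A perturbation of identity on $W$ is a map of the form $w\mapsto w+u(w)$ with $u$ taking values in $H$. A set $A\subset W$ is $H$-invariant if $A+H\subset A$ (equivalently, its complement is $H$-invariant). "Capacity" refers to a capacity on the Wiener space $(W,H,\mu)$ associated with the Gaussian (Malliavin) Sobolev spaces; the statement says only "capacity zero" and does not specify the Sobolev indices of the capacity. *)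

theory Defs
  imports "HOL-Probability.Probability"
begin

section \<open>Wiener spaces\<close>

text \<open>Every Frechet space is metrised by a complete translation-invariant metric; only the
  topology of that metric is used below.\<close>

class frechet_space = real_vector + complete_space +
  assumes dist_add_right: "dist (x + z) (y + z) = dist x y"
    and continuous_scaleR: "0 < \<epsilon> \<Longrightarrow>
      \<exists>\<delta>>0. \<forall>s y. \<bar>s - r\<bar> < \<delta> \<longrightarrow> dist y x < \<delta> \<longrightarrow> dist (s *\<^sub>R y) (r *\<^sub>R x) < \<epsilon>"
    and locally_convex: "0 < \<epsilon> \<Longrightarrow>
      \<exists>V. open V \<and> 0 \<in> V \<and> (\<forall>x\<in>V. dist x 0 < \<epsilon>) \<and>
        (\<forall>x\<in>V. \<forall>y\<in>V. \<forall>u. 0 \<le> u \<longrightarrow> u \<le> 1 \<longrightarrow> (1 - u) *\<^sub>R x + u *\<^sub>R y \<in> V)"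

definition continuous_dual :: "('w::frechet_space \<Rightarrow> real) set" where
  "continuous_dual = {l. linear l \<and> continuous_on UNIV l}"

text \<open>\<open>H\<close> is a Hilbert space of its own (type \<open>'h\<close>), and \<open>\<iota>\<close> is its inclusion into \<open>W\<close>.
  The functional \<open>l\<close> is identified with \<open>e \<in> H\<close> via \<open>l (\<iota> h) = (e, h)\<^sub>H\<close>; by the Riesz theorem
  every element of the dual is identified with exactly one \<open>e\<close>.\<close>

definition riesz_representative ::
    "('h::{real_inner, complete_space} \<Rightarrow> 'w::frechet_space) \<Rightarrow> 'h \<Rightarrow> ('w \<Rightarrow> real) \<Rightarrow> bool" where
  "riesz_representative \<iota> e l \<longleftrightarrow> l \<in> continuous_dual \<and> (\<forall>h. l (\<iota> h) = e \<bullet> h)"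

text \<open>Abstract Wiener space in the sense of Gross: \<open>H\<close> is densely and continuously embedded in \<open>W\<close>,
  and under \<open>\<mu>\<close> each \<open>l \<in> W\<^sup>*\<close> has law \<open>N(0, \<bar>l\<bar>\<^sub>H\<^sup>2)\<close>, i.e. \<open>\<mu>\<close> is centred Gaussian and the inner
  product of \<open>H\<close> reproduces its covariance, so \<open>H\<close> is the Cameron-Martin space of \<open>\<mu>\<close>.\<close>

definition wiener_space ::
    "'w::frechet_space measure \<Rightarrow> ('h::{real_inner, complete_space} \<Rightarrow> 'w) \<Rightarrow> bool" where
  "wiener_space \<mu> \<iota> \<longleftrightarrow>
     prob_space \<mu> \<and> sets \<mu> = sets borel \<and>
     linear \<iota> \<and> inj \<iota> \<and> continuous_on UNIV \<iota> \<and> closure (range \<iota>) = UNIV \<and>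
     (\<forall>e l. riesz_representative \<iota> e l \<longrightarrow>
        (\<forall>s. char (distr \<mu> borel l) s = complex_of_real (exp (- (s * norm e)\<^sup>2 / 2))))"

definition dual_in_H :: "('h::{real_inner, complete_space} \<Rightarrow> 'w::frechet_space) \<Rightarrow> 'h set" where
  "dual_in_H \<iota> = {e. \<exists>l. riesz_representative \<iota> e l}"

text \<open>For \<open>e \<in> W\<^sup>*\<close> the divergence \<open>\<delta> e\<close> is the everywhere defined pairing \<open>w \<mapsto> \<langle>e, w\<rangle>\<close>. The
  functional is unique because \<open>H\<close> is dense in \<open>W\<close>.\<close>

definition divergence ::
    "('h::{real_inner, complete_space} \<Rightarrow> 'w::frechet_space) \<Rightarrow> 'h \<Rightarrow> 'w \<Rightarrow> real" where
  "divergence \<iota> e = (THE l. riesz_representative \<iota> e l)"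

definition orthonormal_basis :: "(nat \<Rightarrow> 'h::real_inner) \<Rightarrow> bool" where
  "orthonormal_basis e \<longleftrightarrow>
     (\<forall>m n. e m \<bullet> e n = (if m = n then 1 else 0)) \<and> closure (span (range e)) = UNIV"

definition H_invariant :: "('h \<Rightarrow> 'w::plus) \<Rightarrow> 'w set \<Rightarrow> bool" where
  "H_invariant \<iota> A \<longleftrightarrow> (\<forall>w\<in>A. \<forall>h. w + \<iota> h \<in> A)"

text \<open>\<open>h \<mapsto> F (w + h)\<close> is continuously Frechet differentiable on \<open>H\<close>.\<close>

definition C1_along_H ::
    "('h::{real_inner, complete_space} \<Rightarrow> 'w::frechet_space) \<Rightarrow> ('w \<Rightarrow> 'h) \<Rightarrow> 'w \<Rightarrow> bool" where
  "C1_along_H \<iota> F w \<longleftrightarrow>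
     (\<exists>D :: 'h \<Rightarrow> 'h \<Rightarrow>\<^sub>L 'h.
        (\<forall>h. ((\<lambda>k. F (w + \<iota> k)) has_derivative blinfun_apply (D h)) (at h)) \<and>
        continuous_on UNIV D)"


section \<open>Sobolev capacities\<close>

text \<open>Mehler's formula for the Ornstein-Uhlenbeck semigroup.\<close>

definition ornstein_uhlenbeck ::
    "'w::frechet_space measure \<Rightarrow> real \<Rightarrow> ('w \<Rightarrow> real) \<Rightarrow> 'w \<Rightarrow> real" where
  "ornstein_uhlenbeck \<mu> \<tau> f w =
     (\<integral>y. f (exp (- \<tau>) *\<^sub>R w + sqrt (1 - exp (- 2 * \<tau>)) *\<^sub>R y) \<partial>\<mu>)"

text \<open>The Bessel potential \<open>(I + L) powr (- r / 2)\<close>, where \<open>- L\<close> generates the semigroup. The Gaussian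
  Sobolev space \<open>D\<^sub>p\<^sub>,\<^sub>r\<close> is its image of \<open>L\<^sup>p \<mu>\<close>, with norm
  \<open>\<parallel>\<phi>\<parallel>\<^sub>p\<^sub>,\<^sub>r = \<parallel>f\<parallel>\<^sub>p\<close> for \<open>\<phi> = bessel_potential \<mu> r f\<close>.\<close>

definition bessel_potential ::
    "'w::frechet_space measure \<Rightarrow> real \<Rightarrow> ('w \<Rightarrow> real) \<Rightarrow> 'w \<Rightarrow> real" where
  "bessel_potential \<mu> r f w =
     (LBINT \<tau>:{0<..}. \<tau> powr (r / 2 - 1) * exp (- \<tau>) * ornstein_uhlenbeck \<mu> \<tau> f w) / Gamma (r / 2)"

definition p_energy :: "'w measure \<Rightarrow> real \<Rightarrow> ('w \<Rightarrow> real) \<Rightarrow> ennreal" where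
  "p_energy \<mu> p f = (\<integral>\<^sup>+w. ennreal (\<bar>f w\<bar> powr p) \<partial>\<mu>)"

text \<open>\<open>C\<^sub>p\<^sub>,\<^sub>r(G) = inf {\<parallel>\<phi>\<parallel>\<^sub>p\<^sub>,\<^sub>r\<^sup>p. \<phi> \<in> D\<^sub>p\<^sub>,\<^sub>r, \<phi> \<ge> 1 a.e. on G}\<close> for open \<open>G\<close>, extended to all sets
  by outer approximation with open sets.\<close>

definition open_capacity ::
    "'w::frechet_space measure \<Rightarrow> real \<Rightarrow> real \<Rightarrow> 'w set \<Rightarrow> ennreal" where
  "open_capacity \<mu> p r G =
     (INF f\<in>{f \<in> borel_measurable \<mu>. p_energy \<mu> p f < \<infinity> \<and>
               (AE w in \<mu>. w \<in> G \<longrightarrow> 1 \<le> bessel_potential \<mu> r f w)}. p_energy \<mu> p f)"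

definition capacity ::
    "'w::frechet_space measure \<Rightarrow> real \<Rightarrow> real \<Rightarrow> 'w set \<Rightarrow> ennreal" where
  "capacity \<mu> p r A = (INF G\<in>{G. open G \<and> A \<subseteq> G}. open_capacity \<mu> p r G)"


section \<open>Semimartingales\<close>

definition usual_conditions :: "'a measure \<Rightarrow> (real \<Rightarrow> 'a measure) \<Rightarrow> bool" where
  "usual_conditions P F \<longleftrightarrow>
     prob_space P \<and> complete_measure P \<and>
     (\<forall>t\<ge>0. subalgebra P (F t)) \<and>
     (\<forall>s\<ge>0. \<forall>t\<ge>s. sets (F s) \<subseteq> sets (F t)) \<and>
     null_sets P \<subseteq> sets (F 0) \<and>
     (\<forall>s\<ge>0. sets (F s) = (\<Inter>t\<in>{s<..}. sets (F t)))"

text \<open>Time is \<open>[0, \<infinity>)\<close>, while stopping times take values in \<open>[0, \<infinity>]\<close>; the library's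
  \<open>stopping_time\<close> would force both to be the same type.\<close>

definition halfline_stopping_time :: "(real \<Rightarrow> 'a measure) \<Rightarrow> ('a \<Rightarrow> ennreal) \<Rightarrow> bool" where
  "halfline_stopping_time F T \<longleftrightarrow> (\<forall>t\<ge>0. Measurable.pred (F t) (\<lambda>z. T z \<le> ennreal t))"

definition adapted :: "(real \<Rightarrow> 'a measure) \<Rightarrow> (real \<Rightarrow> 'a \<Rightarrow> real) \<Rightarrow> bool" where
  "adapted F X \<longleftrightarrow> (\<forall>t\<ge>0. X t \<in> borel_measurable (F t))"

definition cadlag :: "(real \<Rightarrow> real) \<Rightarrow> bool" where
  "cadlag x \<longleftrightarrow> (\<forall>t\<ge>0. (x \<longlongrightarrow> x t) (at_right t)) \<and> (\<forall>t>0. \<exists>l. (x \<longlongrightarrow> l) (at_left t))"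

definition cadlag_process :: "'a measure \<Rightarrow> (real \<Rightarrow> 'a \<Rightarrow> real) \<Rightarrow> bool" where
  "cadlag_process P X \<longleftrightarrow> (\<forall>z\<in>space P. cadlag (\<lambda>t. X t z))"

definition martingale ::
    "'a measure \<Rightarrow> (real \<Rightarrow> 'a measure) \<Rightarrow> (real \<Rightarrow> 'a \<Rightarrow> real) \<Rightarrow> bool" where
  "martingale P F X \<longleftrightarrow>
     adapted F X \<and> (\<forall>t\<ge>0. integrable P (X t)) \<and>
     (\<forall>s\<ge>0. \<forall>t\<ge>s. AE z in P. real_cond_exp P (F s) (X t) z = X s z)"

definition stopped :: "('a \<Rightarrow> ennreal) \<Rightarrow> (real \<Rightarrow> 'a \<Rightarrow> real) \<Rightarrow> real \<Rightarrow> 'a \<Rightarrow> real" where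
  "stopped \<tau> X t z = X (enn2real (min (ennreal t) (\<tau> z))) z"

definition local_martingale ::
    "'a measure \<Rightarrow> (real \<Rightarrow> 'a measure) \<Rightarrow> (real \<Rightarrow> 'a \<Rightarrow> real) \<Rightarrow> bool" where
  "local_martingale P F M \<longleftrightarrow>
     adapted F M \<and> cadlag_process P M \<and>
     (\<exists>\<tau>. (\<forall>n::nat. halfline_stopping_time F (\<tau> n)) \<and>
          (AE z in P. incseq (\<lambda>n. \<tau> n z) \<and> (\<lambda>n. \<tau> n z) \<longlonglongrightarrow> \<infinity>) \<and>
          (\<forall>n. martingale P F (\<lambda>t z. stopped (\<tau> n) M t z - M 0 z)))"

definition finite_variation_on :: "real \<Rightarrow> (real \<Rightarrow> real) \<Rightarrow> bool" where
  "finite_variation_on t x \<longleftrightarrow>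
     (\<exists>B. \<forall>(s::nat \<Rightarrow> real) n. incseq s \<and> 0 \<le> s 0 \<and> s n \<le> t \<longrightarrow>
        (\<Sum>i<n. \<bar>x (s (Suc i)) - x (s i)\<bar>) \<le> B)"

definition finite_variation_process ::
    "'a measure \<Rightarrow> (real \<Rightarrow> 'a measure) \<Rightarrow> (real \<Rightarrow> 'a \<Rightarrow> real) \<Rightarrow> bool" where
  "finite_variation_process P F A \<longleftrightarrow>
     adapted F A \<and> cadlag_process P A \<and>
     (\<forall>z\<in>space P. \<forall>t\<ge>0. finite_variation_on t (\<lambda>s. A s z))"

definition semimartingale ::
    "'a measure \<Rightarrow> (real \<Rightarrow> 'a measure) \<Rightarrow> (real \<Rightarrow> 'a \<Rightarrow> real) \<Rightarrow> bool" where
  "semimartingale P F Z \<longleftrightarrow>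
     adapted F Z \<and> cadlag_process P Z \<and>
     (\<exists>M A. local_martingale P F M \<and> finite_variation_process P F A \<and>
        (AE z in P. \<forall>t\<ge>0. Z t z = M t z + A t z))"

text \<open>Convention \<open>Z\<^sub>0\<^sub>- = Z\<^sub>0\<close>: there is no jump at time \<open>0\<close>.\<close>

definition jump :: "(real \<Rightarrow> 'a \<Rightarrow> real) \<Rightarrow> real \<Rightarrow> 'a \<Rightarrow> real" where
  "jump Z s z = (if s = 0 then 0 else Z s z - Lim (at_left s) (\<lambda>r. Z r z))"

definition graph :: "'a measure \<Rightarrow> ('a \<Rightarrow> ennreal) \<Rightarrow> (real \<times> 'a) set" where
  "graph P T = {(s, z). 0 \<le> s \<and> z \<in> space P \<and> T z = ennreal s}"

definition absorbs_jumps ::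
    "'a measure \<Rightarrow> (real \<Rightarrow> 'a \<Rightarrow> real) \<Rightarrow> (nat \<Rightarrow> 'a \<Rightarrow> ennreal) \<Rightarrow> bool" where
  "absorbs_jumps P Z T \<longleftrightarrow>
     {(s, z). 0 \<le> s \<and> z \<in> space P \<and> jump Z s z \<noteq> 0} \<subseteq> (\<Union>n. graph P (T n)) \<and>
     disjoint_family (\<lambda>n. graph P (T n))"


section \<open>The perturbation\<close>

definition pert_term ::
    "('h::{real_inner, complete_space} \<Rightarrow> 'w::frechet_space) \<Rightarrow> (nat \<Rightarrow> 'h) \<Rightarrow>
     (real \<Rightarrow> 'a \<Rightarrow> real) \<Rightarrow> (nat \<Rightarrow> 'a \<Rightarrow> ennreal) \<Rightarrow> 'w \<Rightarrow> 'a \<Rightarrow> nat \<Rightarrow> 'h" where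
  "pert_term \<iota> e Z T w z n = (jump Z (enn2real (T n z)) z * divergence \<iota> (e n) w) *\<^sub>R e n"

text \<open>The series is meant in the norm of \<open>H\<close>; its terms are orthogonal, so conditional and
  unconditional convergence agree.\<close>

definition pert ::
    "('h::{real_inner, complete_space} \<Rightarrow> 'w::frechet_space) \<Rightarrow> (nat \<Rightarrow> 'h) \<Rightarrow>
     (real \<Rightarrow> 'a \<Rightarrow> real) \<Rightarrow> (nat \<Rightarrow> 'a \<Rightarrow> ennreal) \<Rightarrow> real \<Rightarrow> 'w \<Rightarrow> 'a \<Rightarrow> 'h" where
  "pert \<iota> e Z T t w z = (\<Sum>\<^sub>\<infinity>n\<in>{n. T n z \<le> ennreal t}. pert_term \<iota> e Z T w z n)"

definition pert_defined ::
    "('h::{real_inner, complete_space} \<Rightarrow> 'w::frechet_space) \<Rightarrow> (nat \<Rightarrow> 'h) \<Rightarrow>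
     (real \<Rightarrow> 'a \<Rightarrow> real) \<Rightarrow> (nat \<Rightarrow> 'a \<Rightarrow> ennreal) \<Rightarrow> real \<Rightarrow> 'w \<Rightarrow> 'a \<Rightarrow> bool" where
  "pert_defined \<iota> e Z T t w z \<longleftrightarrow> pert_term \<iota> e Z T w z summable_on {n. T n z \<le> ennreal t}"

definition pert_map ::
    "('h::{real_inner, complete_space} \<Rightarrow> 'w::frechet_space) \<Rightarrow> (nat \<Rightarrow> 'h) \<Rightarrow>
     (real \<Rightarrow> 'a \<Rightarrow> real) \<Rightarrow> (nat \<Rightarrow> 'a \<Rightarrow> ennreal) \<Rightarrow> real \<Rightarrow> 'w \<Rightarrow> 'a \<Rightarrow> 'w" where
  "pert_map \<iota> e Z T t w z = w + \<iota> (pert \<iota> e Z T t w z)"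

end

theory Submission
  imports Defs
begin

text \<open>The terms of the series are orthogonal, so everything rests on \<open>q w = (\<Sum>n. (a n * \<delta> e\<^sub>n w)\<^sup>2)\<close>, where \<open>a n\<close>
  is the jump of \<open>Z\<close> at \<open>T\<^sub>n\<close> if \<open>T\<^sub>n \<le> t\<close>. The \<open>a n\<close> are almost surely square summable: for a local
  martingale, which need not be square integrable, this follows from the weak type bound for the square
  function over grids and Fatou's lemma. Since the \<open>\<delta> e\<^sub>n\<close> are standard normal, \<open>q\<close> is integrable. Off the
  \<open>H\<close>-invariant set \<open>q = \<infinity>\<close> the perturbation is affine along \<open>H\<close> with a bounded diagonal linear part.
  That set has capacity zero because the Bessel potential of \<open>q\<close> is at least a positive multiple of \<open>q\<close>
  and \<open>q\<close> has moments of all orders, so multiples of \<open>q\<close> are admissible potentials for \<open>q > \<lambda>\<close> whose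
  energy vanishes as \<open>\<lambda>\<close> tends to infinity.\<close>

text \<open>The probabilistic obstacle is integrability: a martingale is only in L^1, so the sum of
  its squared increments may have infinite mean. Restricted to paths that stay between -L and L at
  all grid points, its mean is at most 2 L E|X_t|, the same bound for every grid; each cadlag path
  satisfies the restriction on [0,t] for some L. Fatou's lemma then gives a bound along infinitely
  many grids only, but this already controls every finite set of jumps. On the Gaussian side
  everything is drawn from the linearity and the one-dimensional laws of the divergences: means and
  second moments give Mehler's formula for the quadratic form, and convexity reduces its higher
  moments to those of one normal variable. Moments of every order make one and the same exceptional
  set work for all p > 1 and r > 0. The first assertion also needs joint measurability in the pair
  (w, z), hence measurability of the jump at a stopping time.\<close>

section \<open>The square function of a martingale\<close>

text \<open>\<open>X t\<close> is merely integrable, so boundedness of the weight is what makes the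
  products integrable. Two weights occur below: the truncated value of X, and a sign on the event of
  leaving the interval.\<close>

lemma martingale_integral_mult:
  assumes U: "usual_conditions P F" and X: "martingale P F X" and st: "0 \<le> s" "s \<le> t"
    and g: "g \<in> borel_measurable (F s)" and B: "\<And>z. \<bar>g z\<bar> \<le> B"
  shows "integrable P (\<lambda>z. g z * X t z)" "integrable P (\<lambda>z. g z * X s z)"
    "(\<integral>z. g z * X t z \<partial>P) = (\<integral>z. g z * X s z \<partial>P)"
proof -
  interpret prob_space P using U by (simp add: usual_conditions_def)
  have sub: "subalgebra P (F s)" using U st by (simp add: usual_conditions_def)
  interpret finite_measure_subalgebra P "F s" by unfold_locales (rule sub)
  have gP[measurable]: "g \<in> borel_measurable P" by (rule measurable_from_subalg[OF sub g])
  have i: "integrable P (X t)" "integrable P (X s)" using X st by (auto simp: martingale_def)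
  have m[measurable]: "X t \<in> borel_measurable P" "X s \<in> borel_measurable P" using i by auto
  have I: "integrable P (\<lambda>z. g z * Y z)" if "integrable P Y" for Y
    by (rule Bochner_Integration.integrable_bound[of _ "\<lambda>z. B * Y z"])
      (use that B in \<open>auto simp: abs_mult intro!: mult_mono order_trans[OF B]\<close>)
  show "integrable P (\<lambda>z. g z * X t z)" "integrable P (\<lambda>z. g z * X s z)" using I i by auto
  have "(\<integral>z. g z * X t z \<partial>P) = (\<integral>z. g z * real_cond_exp P (F s) (X t) z \<partial>P)"
    by (rule real_cond_exp_intg(2)[symmetric]) (use g I i in auto)
  also have "\<dots> = (\<integral>z. g z * X s z \<partial>P)"
    by (rule integral_cong_AE) (use X st in \<open>auto simp: martingale_def elim!: eventually_mono\<close>)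
  finally show "(\<integral>z. g z * X t z \<partial>P) = (\<integral>z. g z * X s z \<partial>P)" .
qed

text \<open>Multiplying (x' - x)^2 = x'^2 - x^2 - 2 x (x' - x) by the weight leaves an error term
  only where I drops. There \<open>x k\<close> still lies in the interval, so the value after the
  exit enters to the first power only, which an L^1 bound can handle. For an indicator,
  \<open>I (Suc k)\<close> on the left discards the step of the exit, whereas the transform carries
  \<open>I k\<close>, which is known at time k.\<close>

lemma truncated_square_sum_bound:
  fixes x I :: "nat \<Rightarrow> real"
  assumes I: "\<And>k. 0 \<le> I k" "\<And>k. I (Suc k) \<le> I k" and L: "\<And>k. I k = 0 \<or> \<bar>x k\<bar> \<le> L"
  shows "(\<Sum>k<n. I (Suc k) * (x (Suc k) - x k)\<^sup>2) \<le> L * (I n * \<bar>x n\<bar>)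
      + (\<Sum>k<n. 2 * L * ((I k - I (Suc k)) * \<bar>x (Suc k)\<bar>) - 2 * ((I k * x k) * (x (Suc k) - x k)))"
proof -
  have b: "I k * (x k * y) \<le> I k * (L * \<bar>y\<bar>)" for k y
  proof (cases "I k = 0")
    case False
    then have "\<bar>x k\<bar> * \<bar>y\<bar> \<le> L * \<bar>y\<bar>" using L[of k] by (intro mult_right_mono) auto
    then have "x k * y \<le> L * \<bar>y\<bar>" using abs_ge_self[of "x k * y"] by (simp add: abs_mult)
    then show ?thesis using I by (intro mult_left_mono) auto
  qed simp
  have st: "I (Suc k) * (x (Suc k) - x k)\<^sup>2 \<le> I (Suc k) * (x (Suc k))\<^sup>2 - I k * (x k)\<^sup>2
      + (2 * L * ((I k - I (Suc k)) * \<bar>x (Suc k)\<bar>) - 2 * ((I k * x k) * (x (Suc k) - x k)))" for k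
  proof -
    have "(I k - I (Suc k)) * (2 * (x k * x (Suc k)) - (x k)\<^sup>2)
        \<le> (I k - I (Suc k)) * (2 * (L * \<bar>x (Suc k)\<bar>))"
    proof (cases "I k = 0")
      case True
      then have "I (Suc k) = 0" using I(1)[of "Suc k"] I(2)[of k] by simp
      then show ?thesis using True by simp
    next
      case False
      then have "0 < I k" using I(1)[of k] by simp
      then have "x k * x (Suc k) \<le> L * \<bar>x (Suc k)\<bar>" using b[of k "x (Suc k)"] by simp
      moreover have "0 \<le> (x k)\<^sup>2" by simp
      ultimately have "2 * (x k * x (Suc k)) - (x k)\<^sup>2 \<le> 2 * (L * \<bar>x (Suc k)\<bar>)" by linarith
      then show ?thesis using I(2)[of k] by (intro mult_left_mono) auto
    qed
    then show ?thesis by (simp add: power2_eq_square algebra_simps)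
  qed
  have 1: "(\<Sum>k<n. I (Suc k) * (x (Suc k) - x k)\<^sup>2) \<le> I n * (x n)\<^sup>2 - I 0 * (x 0)\<^sup>2
      + (\<Sum>k<n. 2 * L * ((I k - I (Suc k)) * \<bar>x (Suc k)\<bar>) - 2 * ((I k * x k) * (x (Suc k) - x k)))"
  proof (induction n)
    case (Suc n) show ?case using add_mono[OF Suc st[of n]] by simp
  qed simp
  have "I n * (x n * x n) \<le> I n * (L * \<bar>x n\<bar>)" by (rule b)
  moreover have "0 \<le> I 0 * (x 0)\<^sup>2" using I by simp
  ultimately show ?thesis using 1 by (simp add: power2_eq_square mult_ac)
qed

text \<open>Weak type (1,1) bound for the square function, by summation by parts: until the martingale
  leaves the interval from \<open>-L\<close> to \<open>L\<close>, the transform with integrand \<open>X\<close> is bounded and has mean \<open>0\<close>.\<close>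

lemma martingale_square_function:
  fixes p :: "nat \<Rightarrow> real" and L :: real
  assumes U: "usual_conditions P F" and X: "martingale P F X" and p: "incseq p" "0 \<le> p 0"
    and L: "0 \<le> L"
  defines "I \<equiv> \<lambda>k z. of_bool (\<forall>j\<le>k. \<bar>X (p j) z\<bar> \<le> L) :: real"
  shows "(\<integral>\<^sup>+z. ennreal (I N z * (\<Sum>k<N. (X (p (Suc k)) z - X (p k) z)\<^sup>2)) \<partial>P)
      \<le> ennreal (2 * L * (\<integral>z. \<bar>X (p N) z\<bar> \<partial>P))"
proof -
  interpret prob_space P using U by (simp add: usual_conditions_def)
  have p0: "0 \<le> p k" for k using p by (metis incseqD le0 order_trans)
  have pm: "p j \<le> p k" if "j \<le> k" for j k using p(1) that by (simp add: incseqD)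
  have sub: "subalgebra P (F (p k))" for k using U p0 by (simp add: usual_conditions_def)
  have spF: "space (F (p k)) = space P" for k using sub[of k] by (simp add: subalgebra_def)
  have sF: "subalgebra (F (p k)) (F (p j))" if "j \<le> k" for j k
  proof -
    have "sets (F (p j)) \<subseteq> sets (F (p k))"
      using U pm[OF that] p0[of j] unfolding usual_conditions_def by blast
    then show ?thesis by (simp add: subalgebra_def spF)
  qed
  have XF: "X (p j) \<in> borel_measurable (F (p k))" if "j \<le> k" for j k
    using X p0[of j] measurable_from_subalg[OF sF[OF that]] by (auto simp: martingale_def adapted_def)
  have IF: "I k \<in> borel_measurable (F (p k))" for k
  proof -
    have "Measurable.pred (F (p k)) (\<lambda>z. \<forall>j\<in>{..k}. \<bar>X (p j) z\<bar> \<le> L)"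
    proof (intro pred_intros_finite)
      fix j assume "j \<in> {..k}"
      then have [measurable]: "X (p j) \<in> borel_measurable (F (p k))" using XF by auto
      show "Measurable.pred (F (p k)) (\<lambda>z. \<bar>X (p j) z\<bar> \<le> L)" by measurable
    qed simp
    then have "(\<lambda>z. of_bool (\<forall>j\<in>{..k}. \<bar>X (p j) z\<bar> \<le> L) :: real) \<in> borel_measurable (F (p k))"
      by (rule measurable_compose) simp
    moreover have "I k = (\<lambda>z. of_bool (\<forall>j\<in>{..k}. \<bar>X (p j) z\<bar> \<le> L))"
      by (auto simp: I_def fun_eq_iff)
    ultimately show ?thesis by (rule ssubst[rotated])
  qed
  have IF': "I j \<in> borel_measurable (F (p k))" if "j \<le> k" for j k
    using measurable_from_subalg[OF sF[OF that] IF] .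
  have Xi: "integrable P (X (p k))" for k using X p0 by (auto simp: martingale_def)
  have [measurable]: "X (p k) \<in> borel_measurable P" for k using Xi by auto
  have [measurable]: "I k \<in> borel_measurable P" for k using measurable_from_subalg[OF sub IF] .
  have I01: "0 \<le> I k z" "I k z \<le> 1" "I (Suc k) z \<le> I k z" for k z
    by (auto simp: I_def of_bool_def)
  have IL: "I k z * \<bar>X (p k) z\<bar> \<le> I k z * L" "I k z = 0 \<or> \<bar>X (p k) z\<bar> \<le> L" for k z by (auto simp: I_def)
  define d where "d k z = X (p (Suc k)) z - X (p k) z" for k z
  have ab: "(\<Sum>k<n. I (Suc k) z * (d k z)\<^sup>2) \<le> L * (I n z * \<bar>X (p n) z\<bar>)
      + (\<Sum>k<n. 2 * L * ((I k z - I (Suc k) z) * \<bar>X (p (Suc k)) z\<bar>) - 2 * ((I k z * X (p k) z) * d k z))" for n z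
    unfolding d_def by (rule truncated_square_sum_bound) (use I01 IL in auto)
  have tr: "integrable P (\<lambda>z. (I k z * X (p k) z) * d k z)" "(\<integral>z. (I k z * X (p k) z) * d k z \<partial>P) = 0" for k
  proof -
    have b: "\<bar>I k z * X (p k) z\<bar> \<le> L" for z using IL(2)[of k z] I01[of k z] L by (auto simp: I_def)
    have m: "(\<lambda>z. I k z * X (p k) z) \<in> borel_measurable (F (p k))"
      using IF XF[OF order_refl] by measurable
    note M = martingale_integral_mult[OF U X p0 pm[of k "Suc k", OF le_SucI[OF order_refl]] m b]
    show "integrable P (\<lambda>z. (I k z * X (p k) z) * d k z)" "(\<integral>z. (I k z * X (p k) z) * d k z \<partial>P) = 0"
      using M by (auto simp: d_def right_diff_distrib)
  qed
  have Ji: "integrable P (\<lambda>z. g z * \<bar>X (p k) z\<bar>)"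
    if [measurable]: "g \<in> borel_measurable P" and "\<And>z. \<bar>g z\<bar> \<le> 1" for g :: "_ \<Rightarrow> real" and k
    by (rule Bochner_Integration.integrable_bound[of _ "X (p k)"])
      (use that Xi in \<open>auto simp: abs_mult mult_left_le_one_le\<close>)
  have D1: "\<bar>I k z - I (Suc k) z\<bar> \<le> 1" for k z using I01[of k z] I01[of "Suc k" z] by auto
  have sm: "(\<integral>z. (I k z - I (Suc k) z) * \<bar>X (p (Suc k)) z\<bar> \<partial>P) \<le> (\<integral>z. (I k z - I (Suc k) z) * \<bar>X (p N) z\<bar> \<partial>P)"
    if "k < N" for k
  proof -
    \<comment> \<open>Submartingale inequality for the absolute value, on the event that the path
      leaves the interval at step k+1: against the sign of X at that step, X has the same integral
      at that step and at step N.\<close>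
    define g where "g z = (I k z - I (Suc k) z) * sgn (X (p (Suc k)) z)" for z
    have b: "\<bar>g z\<bar> \<le> 1" for z using D1 by (auto simp: g_def abs_mult abs_sgn_eq)
    have m: "g \<in> borel_measurable (F (p (Suc k)))"
      unfolding g_def sgn_real_def using IF[of "Suc k"] IF'[of k "Suc k"] XF[of "Suc k" "Suc k"] by measurable
    note M = martingale_integral_mult[OF U X p0 pm[of "Suc k" N, OF Suc_leI[OF that]] m b]
    have "(\<integral>z. (I k z - I (Suc k) z) * \<bar>X (p (Suc k)) z\<bar> \<partial>P) = (\<integral>z. g z * X (p (Suc k)) z \<partial>P)"
      by (rule Bochner_Integration.integral_cong) (auto simp: g_def abs_sgn mult_ac)
    also have "\<dots> = (\<integral>z. g z * X (p N) z \<partial>P)" using M by simp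
    also have "\<dots> \<le> (\<integral>z. (I k z - I (Suc k) z) * \<bar>X (p N) z\<bar> \<partial>P)"
    proof (rule integral_mono[OF M(1) Ji[OF _ D1]])
      fix z
      have "g z * X (p N) z \<le> \<bar>g z\<bar> * \<bar>X (p N) z\<bar>" by (metis abs_ge_self abs_mult)
      also have "\<bar>g z\<bar> \<le> I k z - I (Suc k) z"
        using I01(3)[of k z] by (auto simp: g_def abs_mult abs_sgn_eq)
      finally show "g z * X (p N) z \<le> (I k z - I (Suc k) z) * \<bar>X (p N) z\<bar>" by (simp add: mult_right_mono)
    qed measurable
    finally show ?thesis .
  qed
  define S where "S z = (\<Sum>k<N. 2 * L * ((I k z - I (Suc k) z) * \<bar>X (p (Suc k)) z\<bar>) - 2 * ((I k z * X (p k) z) * d k z))" for z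
  have Di: "integrable P (\<lambda>z. (I k z - I (Suc k) z) * \<bar>X (p j) z\<bar>)" for k j
    by (rule Ji[OF _ D1]) measurable
  have Si: "integrable P S" unfolding S_def by (intro Bochner_Integration.integrable_sum Bochner_Integration.integrable_diff integrable_mult_right Di tr)
  have Ni: "integrable P (\<lambda>z. I k z * \<bar>X (p N) z\<bar>)" for k
    by (rule Ji) (use I01 in auto)
  have SI: "(\<integral>z. S z \<partial>P) = (\<Sum>k<N. 2 * L * (\<integral>z. (I k z - I (Suc k) z) * \<bar>X (p (Suc k)) z\<bar> \<partial>P))"
    unfolding S_def using Di tr
    by (subst Bochner_Integration.integral_sum) (auto simp: Bochner_Integration.integral_diff)
  also have "\<dots> \<le> (\<Sum>k<N. 2 * L * (\<integral>z. (I k z - I (Suc k) z) * \<bar>X (p N) z\<bar> \<partial>P))"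
    using sm L by (intro sum_mono mult_left_mono) auto
  also have "\<dots> = 2 * L * (\<Sum>k<N. (\<integral>z. I k z * \<bar>X (p N) z\<bar> \<partial>P) - (\<integral>z. I (Suc k) z * \<bar>X (p N) z\<bar> \<partial>P))"
    using Ni by (simp add: sum_distrib_left left_diff_distrib Bochner_Integration.integral_diff)
  \<comment> \<open>A path leaves the interval at most once: the weights telescope, so no factor N
    appears.\<close>
  also have "\<dots> = 2 * L * ((\<integral>z. I 0 z * \<bar>X (p N) z\<bar> \<partial>P) - (\<integral>z. I N z * \<bar>X (p N) z\<bar> \<partial>P))"
    using sum_lessThan_telescope'[where f = "\<lambda>k. \<integral>z. I k z * \<bar>X (p N) z\<bar> \<partial>P" and m = N] by simp
  finally have S1: "(\<integral>z. S z \<partial>P) \<le> 2 * L * ((\<integral>z. I 0 z * \<bar>X (p N) z\<bar> \<partial>P) - (\<integral>z. I N z * \<bar>X (p N) z\<bar> \<partial>P))" .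
  have I0: "(\<integral>z. I 0 z * \<bar>X (p N) z\<bar> \<partial>P) \<le> (\<integral>z. \<bar>X (p N) z\<bar> \<partial>P)"
    by (rule integral_mono[OF Ni]) (use Xi I01 in \<open>auto simp: mult_left_le_one_le\<close>)
  have IN: "0 \<le> (\<integral>z. I N z * \<bar>X (p N) z\<bar> \<partial>P)" using I01 by (intro integral_nonneg_AE) auto
  have pt: "I N z * (\<Sum>k<N. (X (p (Suc k)) z - X (p k) z)\<^sup>2) \<le> L * (I N z * \<bar>X (p N) z\<bar>) + S z" for z
  proof -
    have mono: "I N z \<le> I (Suc k) z" if "k < N" for k using that by (auto simp: I_def)
    have "I N z * (\<Sum>k<N. (X (p (Suc k)) z - X (p k) z)\<^sup>2) \<le> (\<Sum>k<N. I (Suc k) z * (d k z)\<^sup>2)"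
      unfolding sum_distrib_left d_def using mono by (intro sum_mono mult_right_mono) auto
    also have "\<dots> \<le> L * (I N z * \<bar>X (p N) z\<bar>) + S z" unfolding S_def by (rule ab)
    finally show ?thesis .
  qed
  have "(\<integral>\<^sup>+z. ennreal (I N z * (\<Sum>k<N. (X (p (Suc k)) z - X (p k) z)\<^sup>2)) \<partial>P)
      \<le> (\<integral>\<^sup>+z. ennreal (L * (I N z * \<bar>X (p N) z\<bar>) + S z) \<partial>P)"
    by (intro nn_integral_mono ennreal_leI pt)
  also have "\<dots> = ennreal (\<integral>z. L * (I N z * \<bar>X (p N) z\<bar>) + S z \<partial>P)"
    by (rule nn_integral_eq_integral) (use Ni Si in \<open>auto intro!: order_trans[OF _ pt] mult_nonneg_nonneg sum_nonneg I01\<close>)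
  also have "\<dots> \<le> ennreal (2 * L * (\<integral>z. \<bar>X (p N) z\<bar> \<partial>P))"
  proof (rule ennreal_leI)
    have "(\<integral>z. L * (I N z * \<bar>X (p N) z\<bar>) + S z \<partial>P) = L * (\<integral>z. I N z * \<bar>X (p N) z\<bar> \<partial>P) + (\<integral>z. S z \<partial>P)"
      using Ni Si by simp
    \<comment> \<open>The end term with factor L is absorbed by the subtracted term with factor 2 L
      left over from the telescoping.\<close>
    also have "\<dots> \<le> 2 * L * (\<integral>z. I 0 z * \<bar>X (p N) z\<bar> \<partial>P)"
      using S1 mult_nonneg_nonneg[OF L IN] by (simp add: algebra_simps)
    also have "\<dots> \<le> 2 * L * (\<integral>z. \<bar>X (p N) z\<bar> \<partial>P)"
      using I0 L by (intro mult_left_mono) auto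
    finally show "(\<integral>z. L * (I N z * \<bar>X (p N) z\<bar>) + S z \<partial>P) \<le> 2 * L * (\<integral>z. \<bar>X (p N) z\<bar> \<partial>P)" .
  qed
  finally show ?thesis .
qed

section \<open>Increments over a grid\<close>

text \<open>The grids are not nested; what matters is that the mesh t / (n+1) tends to 0 and that
  the last point is always t.\<close>

definition grid :: "real \<Rightarrow> nat \<Rightarrow> nat \<Rightarrow> real" where
  "grid t n k = t * real k / real (Suc n)"

definition quad_sum :: "real \<Rightarrow> nat \<Rightarrow> (real \<Rightarrow> real) \<Rightarrow> real" where
  "quad_sum t n x = (\<Sum>k<Suc n. (x (grid t n (Suc k)) - x (grid t n k))\<^sup>2)"

lemma grid_0 [simp]: "grid t n 0 = 0"
  and grid_last [simp]: "grid t n (Suc n) = t"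
  by (simp_all add: grid_def)

lemma grid_Suc: "grid t n (Suc k) = grid t n k + t / real (Suc n)"
  by (simp add: grid_def add_divide_distrib distrib_left)

lemma grid_mono: "0 \<le> t \<Longrightarrow> j \<le> k \<Longrightarrow> grid t n j \<le> grid t n k"
  unfolding grid_def by (intro divide_right_mono mult_left_mono) auto

lemma grid_bounds: "0 \<le> t \<Longrightarrow> k \<le> Suc n \<Longrightarrow> 0 \<le> grid t n k \<and> grid t n k \<le> t"
  using grid_mono[of t 0 k n] grid_mono[of t k "Suc n" n] by simp

lemma quad_sum_add_le: "quad_sum t n (\<lambda>s. x s + y s) \<le> 2 * quad_sum t n x + 2 * quad_sum t n y"
proof -
  have "(a + b)\<^sup>2 \<le> 2 * a\<^sup>2 + 2 * b\<^sup>2" for a b :: real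
    using zero_le_power2[of "a - b"] by (simp add: power2_eq_square algebra_simps)
  then have "(x r + y r - (x s + y s))\<^sup>2 \<le> 2 * (x r - x s)\<^sup>2 + 2 * (y r - y s)\<^sup>2" for r s
    by (metis add_diff_add)
  then show ?thesis unfolding quad_sum_def sum_distrib_left sum.distrib[symmetric] by (intro sum_mono) auto
qed

text \<open>A sum of squares is at most the square of the sum of absolute values, and the total
  variation bounds the latter for all grids at once.\<close>

lemma finite_variation_quad_sum:
  assumes "finite_variation_on t x" and t: "0 \<le> t"
  obtains B where "\<And>n. quad_sum t n x \<le> B"
proof -
  obtain B where B: "\<And>(s::nat \<Rightarrow> real) n. incseq s \<and> 0 \<le> s 0 \<and> s n \<le> t \<Longrightarrow> (\<Sum>i<n. \<bar>x (s (Suc i)) - x (s i)\<bar>) \<le> B"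
    using assms unfolding finite_variation_on_def by blast
  have "quad_sum t n x \<le> B\<^sup>2" for n
  proof -
    let ?d = "\<lambda>k. \<bar>x (grid t n (Suc k)) - x (grid t n k)\<bar>"
    have "(\<Sum>k<Suc n. ?d k) \<le> B"
      using B[of "grid t n" "Suc n"] t by (simp add: incseq_def grid_mono)
    moreover have "0 \<le> (\<Sum>k<Suc n. ?d k)" by (intro sum_nonneg) simp
    ultimately have 1: "(\<Sum>k<Suc n. ?d k)\<^sup>2 \<le> B\<^sup>2" by (intro power_mono)
    have "quad_sum t n x = (\<Sum>k<Suc n. ?d k * ?d k)" by (simp add: quad_sum_def power2_eq_square)
    also have "\<dots> \<le> (\<Sum>k<Suc n. ?d k * (\<Sum>k<Suc n. ?d k))"
      by (intro sum_mono mult_left_mono member_le_sum) auto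
    also have "\<dots> = (\<Sum>k<Suc n. ?d k)\<^sup>2" by (simp only: power2_eq_square sum_distrib_right)
    finally show ?thesis using 1 by simp
  qed
  then show ?thesis by (rule that)
qed

text \<open>The value and the one-sided limits give a bound near each point, and compactness of
  [0,t] makes it global. This is what puts each path into one of the intervals of the
  truncation.\<close>

lemma cadlag_bounded:
  assumes x: "cadlag x" obtains B where "\<And>s. s \<in> {0..t} \<Longrightarrow> \<bar>x s\<bar> \<le> B"
proof -
  have loc: "\<exists>U. open U \<and> s \<in> U \<and> (\<exists>B. \<forall>r\<in>U \<inter> {0..t}. \<bar>x r\<bar> \<le> B)" if s: "s \<in> {0..t}" for s
  proof -
    have bd: "\<exists>B. eventually (\<lambda>r. \<bar>x r\<bar> \<le> B) G" if "(x \<longlongrightarrow> l) G" for l G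
    proof
      have "((\<lambda>r. \<bar>x r\<bar>) \<longlongrightarrow> \<bar>l\<bar>) G" using that by (rule tendsto_rabs)
      then have "eventually (\<lambda>r. \<bar>x r\<bar> < \<bar>l\<bar> + 1) G" by (rule order_tendstoD) simp
      then show "eventually (\<lambda>r. \<bar>x r\<bar> \<le> \<bar>l\<bar> + 1) G" by (rule eventually_mono) simp
    qed
    have "(x \<longlongrightarrow> x s) (at_right s)" using x s unfolding cadlag_def by simp
    then obtain B1 where B1: "eventually (\<lambda>r. \<bar>x r\<bar> \<le> B1) (at_right s)" using bd by blast
    \<comment> \<open>At s = 0 \<open>cadlag\<close> gives no left limit; the guard
      \<open>0 \<le> r\<close> makes that side vacuous.\<close>
    have "\<exists>B2. eventually (\<lambda>r. 0 \<le> r \<longrightarrow> \<bar>x r\<bar> \<le> B2) (at_left s)"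
    proof (cases "s = 0")
      case True
      have "eventually (\<lambda>r. 0 \<le> r \<longrightarrow> \<bar>x r\<bar> \<le> 0) (at_left s)"
        by (rule eventually_mono[OF eventually_at_left_real[of "s - 1" s]]) (use True in auto)
      then show ?thesis by blast
    next
      case False
      then have "0 < s" using s by simp
      then obtain l where "(x \<longlongrightarrow> l) (at_left s)" using x unfolding cadlag_def by blast
      then obtain B where "eventually (\<lambda>r. \<bar>x r\<bar> \<le> B) (at_left s)" using bd by blast
      then have "eventually (\<lambda>r. 0 \<le> r \<longrightarrow> \<bar>x r\<bar> \<le> B) (at_left s)" by (rule eventually_mono) simp
      then show ?thesis by blast
    qed
    then obtain B2 where B2: "eventually (\<lambda>r. 0 \<le> r \<longrightarrow> \<bar>x r\<bar> \<le> B2) (at_left s)" by blast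
    define B where "B = max \<bar>x s\<bar> (max B1 B2)"
    have "eventually (\<lambda>r. 0 \<le> r \<longrightarrow> \<bar>x r\<bar> \<le> B) (at s)"
      unfolding eventually_at_split
    proof
      show "eventually (\<lambda>r. 0 \<le> r \<longrightarrow> \<bar>x r\<bar> \<le> B) (at_left s)"
        by (rule eventually_mono[OF B2]) (auto simp: B_def)
      show "eventually (\<lambda>r. 0 \<le> r \<longrightarrow> \<bar>x r\<bar> \<le> B) (at_right s)"
        by (rule eventually_mono[OF B1]) (auto simp: B_def)
    qed
    then obtain U where U: "open U" "s \<in> U" "\<forall>r\<in>U. r \<noteq> s \<longrightarrow> 0 \<le> r \<longrightarrow> \<bar>x r\<bar> \<le> B"
      unfolding eventually_at_topological by blast
    moreover have "\<bar>x s\<bar> \<le> B" by (simp add: B_def)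
    ultimately have "\<forall>r\<in>U \<inter> {0..t}. \<bar>x r\<bar> \<le> B" by auto
    then show ?thesis using U by blast
  qed
  then obtain U where U: "\<And>s. s \<in> {0..t} \<Longrightarrow> open (U s) \<and> s \<in> U s \<and> (\<exists>B. \<forall>r\<in>U s \<inter> {0..t}. \<bar>x r\<bar> \<le> B)"
    by metis
  have "{0..t} \<subseteq> (\<Union>s\<in>{0..t}. U s)" using U by blast
  then obtain C where C: "C \<subseteq> {0..t}" "finite C" "{0..t} \<subseteq> (\<Union>s\<in>C. U s)"
    using compactE_image[OF compact_Icc[of 0 t], of "{0..t}" U] U by blast
  have "\<forall>s\<in>C. \<exists>B. \<forall>r\<in>U s \<inter> {0..t}. \<bar>x r\<bar> \<le> B" using U C by blast
  then obtain B where B: "\<And>s r. s \<in> C \<Longrightarrow> r \<in> U s \<inter> {0..t} \<Longrightarrow> \<bar>x r\<bar> \<le> B s" by metis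
  have "\<bar>x r\<bar> \<le> (\<Sum>s\<in>C. \<bar>B s\<bar>)" if r: "r \<in> {0..t}" for r
  proof -
    obtain s where s: "s \<in> C" "r \<in> U s" using C r by blast
    have "\<bar>x r\<bar> \<le> \<bar>B s\<bar>" using B[of s r] s r by auto
    also have "\<dots> \<le> (\<Sum>s\<in>C. \<bar>B s\<bar>)" using s C by (intro member_le_sum) auto
    finally show ?thesis .
  qed
  then show ?thesis by (rule that)
qed

text \<open>Index of the grid cell containing s. Cells are open on the left and closed on the right,
  hence ceiling minus one: the left end stays strictly below s and the right end never falls below
  s, which is what a left limit and right continuity ask for.\<close>

definition cell :: "real \<Rightarrow> nat \<Rightarrow> real \<Rightarrow> nat" where
  "cell t n s = nat (\<lceil>s * real (Suc n) / t\<rceil> - 1)"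

lemma cell_iff:
  assumes "0 < s" "s \<le> t"
  shows "grid t n k < s \<and> s \<le> grid t n (Suc k) \<longleftrightarrow> k = cell t n s"
proof -
  have t: "0 < t" using assms by simp
  have "grid t n k < s \<longleftrightarrow> real k < s * real (Suc n) / t"
    using t by (simp add: grid_def field_simps del: of_nat_Suc)
  moreover have "s \<le> grid t n (Suc k) \<longleftrightarrow> s * real (Suc n) / t \<le> real k + 1"
    using t by (simp add: grid_def field_simps del: of_nat_Suc) (simp add: field_simps)
  moreover have "0 < \<lceil>s * real (Suc n) / t\<rceil>" using assms t by simp
  ultimately show ?thesis unfolding cell_def by (simp add: ceiling_eq_iff eq_nat_nat_iff) linarith
qed

lemma cell_less: assumes "0 < s" "s \<le> t" shows "cell t n s < Suc n"
proof (rule ccontr)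
  assume "\<not> ?thesis"
  then have "grid t n (Suc n) \<le> grid t n (cell t n s)" using assms by (intro grid_mono) auto
  moreover have "grid t n (cell t n s) < s" using cell_iff[OF assms] by blast
  ultimately show False using assms by simp
qed

lemma cell_tendsto:
  assumes s: "0 < s" "s \<le> t"
  shows "(\<lambda>n. grid t n (cell t n s)) \<longlonglongrightarrow> s" "(\<lambda>n. grid t n (Suc (cell t n s))) \<longlonglongrightarrow> s"
proof -
  have c: "grid t n (cell t n s) < s" "s \<le> grid t n (Suc (cell t n s))" for n using cell_iff[OF s] by blast+
  have z: "(\<lambda>n. t / real (Suc n)) \<longlonglongrightarrow> 0" by (rule LIMSEQ_Suc[OF lim_const_over_n])
  have l: "(\<lambda>n. s - t / real (Suc n)) \<longlonglongrightarrow> s" "(\<lambda>n. s + t / real (Suc n)) \<longlonglongrightarrow> s"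
    using tendsto_diff[OF tendsto_const z, of s] tendsto_add[OF tendsto_const z, of s] by simp_all
  show "(\<lambda>n. grid t n (cell t n s)) \<longlonglongrightarrow> s"
    by (rule tendsto_sandwich[OF _ _ l(1) tendsto_const])
      (use c in \<open>auto simp: grid_Suc algebra_simps intro!: always_eventually less_imp_le\<close>)
  show "(\<lambda>n. grid t n (Suc (cell t n s))) \<longlonglongrightarrow> s"
    by (rule tendsto_sandwich[OF _ _ tendsto_const l(2)])
      (use c in \<open>auto simp: grid_Suc algebra_simps intro!: always_eventually less_imp_le\<close>)
qed

lemma cell_increment_tendsto:
  assumes x: "cadlag x" and s: "0 < s" "s \<le> t"
  shows "(\<lambda>n. x (grid t n (Suc (cell t n s))) - x (grid t n (cell t n s))) \<longlonglongrightarrow> x s - Lim (at_left s) x"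
proof (rule tendsto_diff)
  have c: "grid t n (cell t n s) < s" "s \<le> grid t n (Suc (cell t n s))" for n using cell_iff[OF s] by blast+
  \<comment> \<open>The right end of the cell may equal s, so the limit is taken within
    \<open>{s..}\<close> and not along \<open>at_right s\<close>.\<close>
  have "continuous (at s within {s..}) x"
    using x s by (simp add: cadlag_def continuous_within at_within_Ici_at_right)
  then show "(\<lambda>n. x (grid t n (Suc (cell t n s)))) \<longlonglongrightarrow> x s"
    by (rule continuous_within_tendsto_compose') (use c cell_tendsto[OF s] in auto)
  obtain l where l: "(x \<longlongrightarrow> l) (at_left s)" using x s unfolding cadlag_def by blast
  have "filterlim (\<lambda>n. grid t n (cell t n s)) (at_left s) sequentially"
    unfolding filterlim_at using cell_tendsto[OF s] c by (auto intro!: always_eventually simp: less_imp_neq)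
  then have "(\<lambda>n. x (grid t n (cell t n s))) \<longlonglongrightarrow> l" using l filterlim_compose by blast
  moreover have "Lim (at_left s) x = l" using l by (intro tendsto_Lim) auto
  ultimately show "(\<lambda>n. x (grid t n (cell t n s))) \<longlonglongrightarrow> Lim (at_left s) x" by simp
qed

text \<open>On fine grids the points of S lie in different cells, so the squared increments over
  these cells form a part of \<open>quad_sum\<close>, and they converge to the squared jumps. As
  this convergence runs along all n, an excess over C would persist for all large n; a bound for
  infinitely many n is therefore enough.\<close>

lemma sum_jumps_le:
  assumes x: "cadlag x" and S: "finite S" "S \<subseteq> {0<..t}"
    and Q: "\<exists>\<^sub>F n in sequentially. quad_sum t n x \<le> C"
  shows "(\<Sum>s\<in>S. (x s - Lim (at_left s) x)\<^sup>2) \<le> C"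
proof -
  define D where "D n s = (x (grid t n (Suc (cell t n s))) - x (grid t n (cell t n s)))\<^sup>2" for n s
  have lim: "(\<lambda>n. \<Sum>s\<in>S. D n s) \<longlonglongrightarrow> (\<Sum>s\<in>S. (x s - Lim (at_left s) x)\<^sup>2)"
    unfolding D_def using S by (intro tendsto_sum tendsto_power cell_increment_tendsto x) auto
  have "eventually (\<lambda>n. cell t n s \<noteq> cell t n s') sequentially" if ss: "s \<in> S" "s' \<in> S" "s \<noteq> s'" for s s'
  proof -
    \<comment> \<open>The left ends of the two cells have different limits, so the cells eventually
      differ.\<close>
    have "(\<lambda>n. grid t n (cell t n s) - grid t n (cell t n s')) \<longlonglongrightarrow> s - s'"
      using ss S by (intro tendsto_diff cell_tendsto) auto
    then have "eventually (\<lambda>n. grid t n (cell t n s) - grid t n (cell t n s') \<noteq> 0) sequentially"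
      using ss(3) by (intro tendsto_imp_eventually_ne) auto
    then show ?thesis by (rule eventually_mono) auto
  qed
  then have "eventually (\<lambda>n. \<forall>s\<in>S. \<forall>s'\<in>S. s \<noteq> s' \<longrightarrow> cell t n s \<noteq> cell t n s') sequentially"
    using S by (intro eventually_ball_finite ballI) (auto elim: eventually_mono)
  then have inj: "eventually (\<lambda>n. inj_on (cell t n) S) sequentially"
    by (rule eventually_mono) (auto simp: inj_on_def)
  have D: "eventually (\<lambda>n. (\<Sum>s\<in>S. D n s) \<le> quad_sum t n x) sequentially"
    using inj
  proof (rule eventually_mono)
    fix n assume i: "inj_on (cell t n) S"
    have "(\<Sum>s\<in>S. D n s) = (\<Sum>k\<in>cell t n ` S. (x (grid t n (Suc k)) - x (grid t n k))\<^sup>2)"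
      by (simp add: sum.reindex[OF i] D_def)
    also have "\<dots> \<le> quad_sum t n x"
      unfolding quad_sum_def using S cell_less by (intro sum_mono2) auto
    finally show "(\<Sum>s\<in>S. D n s) \<le> quad_sum t n x" .
  qed
  show ?thesis
  proof (rule ccontr)
    assume "\<not> ?thesis"
    then have "eventually (\<lambda>n. C < (\<Sum>s\<in>S. D n s)) sequentially" using order_tendstoD(1)[OF lim] by auto
    then have "eventually (\<lambda>n. \<not> quad_sum t n x \<le> C) sequentially" using D by eventually_elim auto
    then show False using Q by (simp add: frequently_def)
  qed
qed

section \<open>Jumps of a semimartingale\<close>

lemma Liminf_less_top_imp_frequently:
  fixes f :: "'a \<Rightarrow> real"
  assumes "Liminf G (\<lambda>n. ennreal (f n)) \<noteq> \<infinity>"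
  obtains C where "frequently (\<lambda>n. f n \<le> C) G"
proof -
  \<comment> \<open>Adding 1 puts C strictly above the limit inferior.\<close>
  define C where "C = enn2real (Liminf G (\<lambda>n. ennreal (f n))) + 1"
  have C: "Liminf G (\<lambda>n. ennreal (f n)) < ennreal C"
    using assms unfolding C_def by (cases "Liminf G (\<lambda>n. ennreal (f n))") (auto simp: ennreal_less_iff)
  have "frequently (\<lambda>n. f n \<le> C) G"
  proof (rule ccontr)
    assume "\<not> ?thesis"
    then have "eventually (\<lambda>n. C < f n) G" by (simp add: frequently_def not_le)
    then have "eventually (\<lambda>n. ennreal C \<le> ennreal (f n)) G" by (rule eventually_mono) (simp add: ennreal_leI)
    then have "ennreal C \<le> Liminf G (\<lambda>n. ennreal (f n))" by (rule Liminf_bounded)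
    then show False using C by simp
  qed
  then show ?thesis by (rule that)
qed

text \<open>Every grid ends in t, so the weak type bound is the same for all n and Fatou's lemma
  makes the limit inferior finite almost surely. Taking L among the naturals keeps the exceptional
  set null for all L simultaneously.\<close>

lemma martingale_quad_sum_frequently_bounded:
  assumes U: "usual_conditions P F" and X: "martingale P F X" and t: "0 \<le> t"
  shows "AE z in P. \<forall>L::nat. \<exists>C. \<exists>\<^sub>F n in sequentially.
    of_bool (\<forall>j\<le>Suc n. \<bar>X (grid t n j) z\<bar> \<le> real L) * quad_sum t n (\<lambda>s. X s z) \<le> C"
  unfolding AE_all_countable
proof
  fix L :: nat
  define f where "f n z = of_bool (\<forall>j\<le>Suc n. \<bar>X (grid t n j) z\<bar> \<le> real L) * quad_sum t n (\<lambda>s. X s z)" for n z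
  have [measurable]: "X (grid t n j) \<in> borel_measurable P" for n j
  proof -
    have "0 \<le> grid t n j" using t by (simp add: grid_def)
    then show ?thesis using X by (auto simp: martingale_def)
  qed
  have I: "(\<lambda>z. of_bool (\<forall>j\<le>Suc n. \<bar>X (grid t n j) z\<bar> \<le> real L) :: real) \<in> borel_measurable P" for n
  proof -
    have "Measurable.pred P (\<lambda>z. \<forall>j\<in>{..Suc n}. \<bar>X (grid t n j) z\<bar> \<le> real L)"
    proof (intro pred_intros_finite)
      fix j show "Measurable.pred P (\<lambda>z. \<bar>X (grid t n j) z\<bar> \<le> real L)" by measurable
    qed simp
    then have "(\<lambda>z. of_bool (\<forall>j\<in>{..Suc n}. \<bar>X (grid t n j) z\<bar> \<le> real L) :: real) \<in> borel_measurable P"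
      by (rule measurable_compose) simp
    moreover have "(\<lambda>z. of_bool (\<forall>j\<le>Suc n. \<bar>X (grid t n j) z\<bar> \<le> real L) :: real)
        = (\<lambda>z. of_bool (\<forall>j\<in>{..Suc n}. \<bar>X (grid t n j) z\<bar> \<le> real L))"
      by (auto simp: fun_eq_iff)
    ultimately show ?thesis by (rule ssubst[rotated])
  qed
  have fm: "f n \<in> borel_measurable P" for n
    unfolding f_def quad_sum_def
    by (intro borel_measurable_times I borel_measurable_sum borel_measurable_power borel_measurable_diff) measurable
  have bound: "(\<integral>\<^sup>+z. ennreal (f n z) \<partial>P) \<le> ennreal (2 * real L * (\<integral>z. \<bar>X t z\<bar> \<partial>P))" for n
    unfolding f_def quad_sum_def
    using martingale_square_function[OF U X, of "grid t n" "real L" "Suc n"] t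
    by (simp add: incseq_def grid_mono)
  have "(\<integral>\<^sup>+z. liminf (\<lambda>n. ennreal (f n z)) \<partial>P) \<le> liminf (\<lambda>n. \<integral>\<^sup>+z. ennreal (f n z) \<partial>P)"
    using fm by (intro nn_integral_liminf) measurable
  also have "\<dots> \<le> limsup (\<lambda>n. \<integral>\<^sup>+z. ennreal (f n z) \<partial>P)" by (intro Liminf_le_Limsup) simp
  also have "\<dots> \<le> ennreal (2 * real L * (\<integral>z. \<bar>X t z\<bar> \<partial>P))"
    by (intro Limsup_bounded always_eventually allI bound)
  finally have "(\<integral>\<^sup>+z. liminf (\<lambda>n. ennreal (f n z)) \<partial>P) \<noteq> \<infinity>" by (auto simp: top_unique)
  then have "AE z in P. liminf (\<lambda>n. ennreal (f n z)) \<noteq> \<infinity>"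
    using fm by (intro nn_integral_PInf_AE) measurable
  then show "AE z in P. \<exists>C. \<exists>\<^sub>F n in sequentially.
    of_bool (\<forall>j\<le>Suc n. \<bar>X (grid t n j) z\<bar> \<le> real L) * quad_sum t n (\<lambda>s. X s z) \<le> C"
  proof (rule eventually_mono)
    fix z assume "liminf (\<lambda>n. ennreal (f n z)) \<noteq> \<infinity>"
    then obtain C where "\<exists>\<^sub>F n in sequentially. f n z \<le> C" by (rule Liminf_less_top_imp_frequently)
    then show "\<exists>C. \<exists>\<^sub>F n in sequentially.
      of_bool (\<forall>j\<le>Suc n. \<bar>X (grid t n j) z\<bar> \<le> real L) * quad_sum t n (\<lambda>s. X s z) \<le> C"
      unfolding f_def by blast
  qed
qed

text \<open>For a fixed path, choose m with \<open>\<tau> m z\<close> beyond t, so that stopping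
  changes nothing on [0,t], and then L beyond a bound for the path, so that the indicator is 1 on
  every grid. Subtracting the initial value does not affect increments.\<close>

lemma local_martingale_quad_sum_frequently_bounded:
  assumes U: "usual_conditions P F" and M: "local_martingale P F M" and t: "0 \<le> t"
  shows "AE z in P. \<exists>C. \<exists>\<^sub>F n in sequentially. quad_sum t n (\<lambda>s. M s z) \<le> C"
proof -
  obtain \<tau> where \<tau>: "AE z in P. incseq (\<lambda>n. \<tau> n z) \<and> (\<lambda>n. \<tau> n z) \<longlonglongrightarrow> (\<infinity>::ennreal)"
    and X: "\<And>m::nat. martingale P F (\<lambda>t z. stopped (\<tau> m) M t z - M 0 z)"
    using M unfolding local_martingale_def by blast
  have cad: "\<And>z. z \<in> space P \<Longrightarrow> cadlag (\<lambda>s. M s z)"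
    using M by (auto simp: local_martingale_def cadlag_process_def)
  have "AE z in P. \<forall>m. \<forall>L::nat. \<exists>C. \<exists>\<^sub>F n in sequentially.
    of_bool (\<forall>j\<le>Suc n. \<bar>stopped (\<tau> m) M (grid t n j) z - M 0 z\<bar> \<le> real L)
      * quad_sum t n (\<lambda>s. stopped (\<tau> m) M s z - M 0 z) \<le> C"
    unfolding AE_all_countable[where 'i = nat and P = "\<lambda>m z. \<forall>L::nat. _ m z L"]
    using martingale_quad_sum_frequently_bounded[OF U X t] by (simp add: AE_all_countable)
  then show ?thesis using \<tau> AE_space
  proof eventually_elim
    case (elim z)
    have "eventually (\<lambda>m. ennreal t < \<tau> m z) sequentially"
      using elim(2) by (intro order_tendstoD(1)[where y = \<infinity>]) auto
    then obtain m where m: "ennreal t < \<tau> m z" by (auto simp: eventually_sequentially)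
    have st: "stopped (\<tau> m) M s z = M s z" if "s \<in> {0..t}" for s
    proof -
      have "ennreal s \<le> \<tau> m z" using m that by (meson atLeastAtMost_iff ennreal_leI less_imp_le order_trans)
      then show ?thesis using that by (simp add: stopped_def min_absorb1)
    qed
    obtain B where B: "\<And>s. s \<in> {0..t} \<Longrightarrow> \<bar>M s z\<bar> \<le> B" using cadlag_bounded[OF cad[OF elim(3)]] by metis
    obtain L :: nat where L: "B + \<bar>M 0 z\<bar> \<le> real L" using real_arch_simple by blast
    have g: "grid t n j \<in> {0..t}" if "j \<le> Suc n" for n j using grid_bounds[OF t that] by simp
    have "(\<forall>j\<le>Suc n. \<bar>stopped (\<tau> m) M (grid t n j) z - M 0 z\<bar> \<le> real L)" for n
    proof (intro allI impI)
      fix j assume "j \<le> Suc n"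
      then have "\<bar>stopped (\<tau> m) M (grid t n j) z\<bar> \<le> B" using st[OF g] B[OF g] by simp
      then show "\<bar>stopped (\<tau> m) M (grid t n j) z - M 0 z\<bar> \<le> real L" using L by linarith
    qed
    moreover have "quad_sum t n (\<lambda>s. stopped (\<tau> m) M s z - M 0 z) = quad_sum t n (\<lambda>s. M s z)" for n
      unfolding quad_sum_def by (intro sum.cong refl) (simp add: st[OF g] less_imp_le)
    ultimately show ?case using elim(1)[rule_format, of m L] by simp
  qed
qed

text \<open>The finite variation part is bounded along all grids, so adding it preserves a bound
  along infinitely many; two bounds of the latter kind could live on disjoint sets of grids.\<close>

lemma semimartingale_quad_sum_frequently_bounded:
  assumes U: "usual_conditions P F" and Z: "semimartingale P F Z" and t: "0 \<le> t"
  shows "AE z in P. \<exists>C. \<exists>\<^sub>F n in sequentially. quad_sum t n (\<lambda>s. Z s z) \<le> C"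
proof -
  obtain M A where M: "local_martingale P F M" and A: "finite_variation_process P F A"
    and MA: "AE z in P. \<forall>t\<ge>0. Z t z = M t z + A t z"
    using Z unfolding semimartingale_def by blast
  show ?thesis
    using local_martingale_quad_sum_frequently_bounded[OF U M t] MA AE_space
  proof eventually_elim
    case (elim z)
    obtain C where C: "\<exists>\<^sub>F n in sequentially. quad_sum t n (\<lambda>s. M s z) \<le> C" using elim(1) by blast
    have "finite_variation_on t (\<lambda>s. A s z)" using A elim(3) t by (simp add: finite_variation_process_def)
    then obtain B where B: "\<And>n. quad_sum t n (\<lambda>s. A s z) \<le> B" using finite_variation_quad_sum t by metis
    have "quad_sum t n (\<lambda>s. Z s z) = quad_sum t n (\<lambda>s. M s z + A s z)" for n
      unfolding quad_sum_def using elim(2) grid_bounds[OF t] by (intro sum.cong refl) simp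
    then have "quad_sum t n (\<lambda>s. Z s z) \<le> 2 * quad_sum t n (\<lambda>s. M s z) + 2 * B" for n
      using quad_sum_add_le[of t n "\<lambda>s. M s z" "\<lambda>s. A s z"] B[of n] by simp
    then have "quad_sum t n (\<lambda>s. Z s z) \<le> 2 * C + 2 * B" if "quad_sum t n (\<lambda>s. M s z) \<le> C" for n
      using that by (smt (verit))
    then show ?case using C by (meson frequently_elim1)
  qed
qed

text \<open>Disjointness of the graphs makes the times up to t distinct for different indices, so a
  finite sum over indices is a sum over distinct jump times and obeys the bound C.\<close>

lemma semimartingale_jumps_square_summable:
  assumes U: "usual_conditions P F" and Z: "semimartingale P F Z" and t: "0 \<le> t"
    and T: "absorbs_jumps P Z T"
  shows "AE z in P. (\<lambda>n. (jump Z (enn2real (T n z)) z)\<^sup>2) summable_on {n. T n z \<le> ennreal t}"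
  using semimartingale_quad_sum_frequently_bounded[OF U Z t] AE_space
proof eventually_elim
  case (elim z)
  obtain C where C: "\<exists>\<^sub>F n in sequentially. quad_sum t n (\<lambda>s. Z s z) \<le> C" using elim(1) by blast
  have cad: "cadlag (\<lambda>s. Z s z)" using Z elim(2) by (auto simp: semimartingale_def cadlag_process_def)
  define s where "s n = enn2real (T n z)" for n
  have Ts: "T n z = ennreal (s n)" "0 \<le> s n" "s n \<le> t" if "T n z \<le> ennreal t" for n
  proof -
    have "T n z < \<top>" using that ennreal_less_top le_less_trans by blast
    then show e: "T n z = ennreal (s n)" by (simp add: s_def)
    show "0 \<le> s n" by (simp add: s_def)
    then show "s n \<le> t" using that e t by simp
  qed
  have inj: "m = n" if "T m z \<le> ennreal t" "T n z \<le> ennreal t" "s m = s n" for m n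
  proof (rule ccontr)
    assume "m \<noteq> n"
    then have "graph P (T m) \<inter> graph P (T n) = {}" using T by (auto simp: absorbs_jumps_def disjoint_family_on_def)
    moreover have "(s m, z) \<in> graph P (T m)" "(s m, z) \<in> graph P (T n)"
      using Ts[OF that(1)] Ts[OF that(2)] that(3) elim(2) by (auto simp: graph_def)
    ultimately show False by blast
  qed
  have "(\<Sum>n\<in>N. (jump Z (s n) z)\<^sup>2) \<le> C" if N: "finite N" "N \<subseteq> {n. T n z \<le> ennreal t}" for N
  proof -
    \<comment> \<open>An index with time 0 contributes nothing, by the convention of
      \<open>jump\<close>; it is removed because \<open>sum_jumps_le\<close> concerns times in
      \<open>{0<..t}\<close>.\<close>
    define N' where "N' = {n\<in>N. s n \<noteq> 0}"
    have i: "inj_on s N'" using inj N by (auto simp: inj_on_def N'_def)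
    have "(\<Sum>n\<in>N. (jump Z (s n) z)\<^sup>2) = (\<Sum>n\<in>N'. (jump Z (s n) z)\<^sup>2)"
      using N by (intro sum.mono_neutral_right) (auto simp: N'_def jump_def)
    also have "\<dots> = (\<Sum>n\<in>N'. (Z (s n) z - Lim (at_left (s n)) (\<lambda>r. Z r z))\<^sup>2)"
      by (intro sum.cong refl) (simp add: N'_def jump_def)
    also have "\<dots> = (\<Sum>r\<in>s ` N'. (Z r z - Lim (at_left r) (\<lambda>r. Z r z))\<^sup>2)" by (simp add: sum.reindex[OF i])
    also have "\<dots> \<le> C"
    proof (rule sum_jumps_le[OF cad _ _ C])
      show "s ` N' \<subseteq> {0<..t}"
      proof
        fix r assume "r \<in> s ` N'"
        then obtain n where "n \<in> N" "s n \<noteq> 0" "r = s n" by (auto simp: N'_def)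
        moreover then have "T n z \<le> ennreal t" using N by blast
        ultimately show "r \<in> {0<..t}" using Ts(2,3)[of n] by simp
      qed
    qed (use N in \<open>simp add: N'_def\<close>)
    finally show ?thesis .
  qed
  then show ?case unfolding s_def[symmetric]
    by (intro nonneg_bdd_above_summable_on bdd_aboveI[where M = C]) auto
qed

text \<open>The jump is the limit of the increments of Z over the grid cell that contains T, and
  each of these is a finite sum of measurable terms.\<close>

lemma measurable_jump_at_stopping_time:
  assumes U: "usual_conditions P F" and A: "adapted F Z" and C: "cadlag_process P Z"
    and T: "halfline_stopping_time F T" and t: "0 \<le> t"
  shows "(\<lambda>z. if T z \<le> ennreal t then jump Z (enn2real (T z)) z else 0) \<in> borel_measurable P"
proof (rule borel_measurable_LIMSEQ_real)
  define c where "c n k z \<longleftrightarrow> \<not> T z \<le> ennreal (grid t n k) \<and> T z \<le> ennreal (grid t n (Suc k))" for n k z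
  define b where "b n z = (\<Sum>k<Suc n. if c n k z then Z (grid t n (Suc k)) z - Z (grid t n k) z else 0)" for n z
  have g0: "0 \<le> grid t n k" for n k using t by (simp add: grid_def)
  have sub: "subalgebra P (F s)" if "0 \<le> s" for s using U that by (simp add: usual_conditions_def)
  have [measurable]: "Z (grid t n k) \<in> borel_measurable P" for n k
    by (rule measurable_from_subalg[OF sub[OF g0]]) (use A g0 in \<open>auto simp: adapted_def\<close>)
  have [measurable]: "Measurable.pred P (\<lambda>z. T z \<le> ennreal (grid t n k))" for n k
    by (rule measurable_from_subalg[OF sub[OF g0]]) (use T g0 in \<open>auto simp: halfline_stopping_time_def\<close>)
  show "b n \<in> borel_measurable P" for n unfolding b_def c_def by measurable
  fix z assume z: "z \<in> space P"
  show "(\<lambda>n. b n z) \<longlonglongrightarrow> (if T z \<le> ennreal t then jump Z (enn2real (T z)) z else 0)"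
  proof (cases "T z \<le> ennreal t \<and> T z \<noteq> 0")
    case True
    define s where "s = enn2real (T z)"
    have "T z < \<top>" using True ennreal_less_top le_less_trans by blast
    then have e: "T z = ennreal s" by (simp add: s_def)
    have s: "0 < s" "s \<le> t"
    proof -
      have "0 \<le> s" by (simp add: s_def)
      moreover have "s \<noteq> 0" using True e by auto
      ultimately show "0 < s" by simp
      then show "s \<le> t" using True e t by simp
    qed
    have "c n k z \<longleftrightarrow> grid t n k < s \<and> s \<le> grid t n (Suc k)" for n k
      unfolding c_def e using s g0 by (simp add: not_le)
    then have "c n k z \<longleftrightarrow> k = cell t n s" for n k using cell_iff[OF s] by simp
    then have "b n z = Z (grid t n (Suc (cell t n s))) z - Z (grid t n (cell t n s)) z" for n
      unfolding b_def using cell_less[OF s, of n] by simp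
    moreover have "cadlag (\<lambda>r. Z r z)" using C z by (simp add: cadlag_process_def)
    ultimately show ?thesis
      using cell_increment_tendsto[of "\<lambda>r. Z r z" s t] s True by (simp add: jump_def s_def[symmetric])
  next
    \<comment> \<open>Two cases: T after t, or T = 0. No cell contains 0, since cells are open on
      the left, which agrees with the absence of a jump at 0.\<close>
    case False
    have "\<not> c n k z" if "k < Suc n" for n k
    proof (cases "T z = 0")
      case False
      then have "\<not> T z \<le> ennreal t" using \<open>\<not> (T z \<le> ennreal t \<and> T z \<noteq> 0)\<close> by simp
      moreover have "ennreal (grid t n (Suc k)) \<le> ennreal t" using grid_bounds[OF t, of "Suc k" n] that by (simp add: ennreal_leI)
      ultimately show ?thesis using order_trans by (auto simp: c_def)
    qed (simp add: c_def)
    then have "b n z = 0" for n by (simp add: b_def)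
    moreover have "(if T z \<le> ennreal t then jump Z (enn2real (T z)) z else 0) = 0"
      using False by (auto simp: jump_def)
    ultimately show ?thesis by simp
  qed
qed

section \<open>Orthonormal series\<close>

lemma norm_sum_orthonormal:
  fixes e :: "nat \<Rightarrow> 'h::real_inner"
  assumes e: "\<And>m n. e m \<bullet> e n = (if m = n then 1 else 0)" and S: "finite S"
  shows "(norm (\<Sum>n\<in>S. x n *\<^sub>R e n))\<^sup>2 = (\<Sum>n\<in>S. (x n)\<^sup>2)"
proof -
  have "(norm (\<Sum>n\<in>S. x n *\<^sub>R e n))\<^sup>2 = (\<Sum>m\<in>S. \<Sum>n\<in>S. x m * (x n * (e m \<bullet> e n)))"
    by (simp add: power2_norm_eq_inner inner_sum_left inner_sum_right sum_distrib_left mult_ac inner_commute)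
  also have "\<dots> = (\<Sum>m\<in>S. \<Sum>n\<in>S. if m = n then (x m)\<^sup>2 else 0)"
    by (intro sum.cong refl) (simp add: e power2_eq_square)
  also have "\<dots> = (\<Sum>n\<in>S. (x n)\<^sup>2)" using S by simp
  finally show ?thesis .
qed

lemma Bessel_inequality:
  fixes e :: "nat \<Rightarrow> 'h::real_inner"
  assumes e: "\<And>m n. e m \<bullet> e n = (if m = n then 1 else 0)" and S: "finite S"
  shows "(\<Sum>n\<in>S. (e n \<bullet> h)\<^sup>2) \<le> (norm h)\<^sup>2"
proof -
  let ?p = "\<Sum>n\<in>S. (e n \<bullet> h) *\<^sub>R e n"
  have "h \<bullet> ?p = (\<Sum>n\<in>S. (e n \<bullet> h)\<^sup>2)"
    by (simp add: inner_sum_right power2_eq_square inner_commute)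
  moreover have "(norm ?p)\<^sup>2 = (\<Sum>n\<in>S. (e n \<bullet> h)\<^sup>2)" by (rule norm_sum_orthonormal[OF e S])
  moreover have "(norm (h - ?p))\<^sup>2 = (norm h)\<^sup>2 - 2 * (h \<bullet> ?p) + (norm ?p)\<^sup>2"
    by (simp add: power2_norm_eq_inner inner_diff_left inner_diff_right inner_commute)
  moreover have "0 \<le> (norm (h - ?p))\<^sup>2" by simp
  ultimately show ?thesis by simp
qed

lemma summable_Bessel:
  fixes e :: "nat \<Rightarrow> 'h::real_inner"
  assumes e: "\<And>m n. e m \<bullet> e n = (if m = n then 1 else 0)"
  shows "summable (\<lambda>n. (e n \<bullet> h)\<^sup>2)"
  by (rule summableI_nonneg_bounded[where x = "(norm h)\<^sup>2", OF _ Bessel_inequality[OF e]]) auto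

lemma orthonormal_series_summable_on:
  fixes e :: "nat \<Rightarrow> 'h::{real_inner, complete_space}"
  assumes e: "\<And>m n. e m \<bullet> e n = (if m = n then 1 else 0)" and x: "summable (\<lambda>n. (x n)\<^sup>2)"
  shows "(\<lambda>n. x n *\<^sub>R e n) summable_on UNIV"
proof -
  let ?s = "\<lambda>S. \<Sum>n\<in>S. x n *\<^sub>R e n"
  \<comment> \<open>The estimate is uniform over all finite supersets of an initial segment. It
    serves twice: for the Cauchy property of the partial sums, and for convergence of the net of
    finite sums to their limit.\<close>
  have near: "\<exists>N. \<forall>S. finite S \<longrightarrow> {..<N} \<subseteq> S \<longrightarrow> norm (?s S - ?s {..<N}) < \<epsilon>" if "0 < \<epsilon>" for \<epsilon>
  proof -
    have "\<exists>N. \<forall>m\<ge>N. \<forall>n. norm (sum (\<lambda>n. (x n)\<^sup>2) {m..<n}) < \<epsilon>\<^sup>2"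
      using x that unfolding summable_Cauchy by simp
    then obtain N where N: "\<And>m n. N \<le> m \<Longrightarrow> norm (sum (\<lambda>n. (x n)\<^sup>2) {m..<n}) < \<epsilon>\<^sup>2" by blast
    have "norm (?s S - ?s {..<N}) < \<epsilon>" if S: "finite S" "{..<N} \<subseteq> S" for S
    proof -
      obtain M where M: "S \<subseteq> {..<M}" using finite_nat_bounded[OF S(1)] by blast
      have "?s S - ?s {..<N} = ?s (S - {..<N})" using S by (simp add: sum_diff)
      then have "(norm (?s S - ?s {..<N}))\<^sup>2 = (\<Sum>n\<in>S - {..<N}. (x n)\<^sup>2)"
        using norm_sum_orthonormal[OF e, of "S - {..<N}" x] S by simp
      also have "\<dots> \<le> sum (\<lambda>n. (x n)\<^sup>2) {N..<M}" using M by (intro sum_mono2) auto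
      also have "\<dots> < \<epsilon>\<^sup>2" using N[of N M] by (auto dest: abs_less_iff[THEN iffD1])
      finally show ?thesis using \<open>0 < \<epsilon>\<close> by (simp add: power_less_imp_less_base)
    qed
    then show ?thesis by blast
  qed
  have "Cauchy (\<lambda>n. ?s {..<n})"
  proof (rule CauchyI)
    fix \<epsilon> :: real assume "0 < \<epsilon>"
    then obtain N where N: "\<And>S. finite S \<Longrightarrow> {..<N} \<subseteq> S \<Longrightarrow> norm (?s S - ?s {..<N}) < \<epsilon> / 2"
      using near[of "\<epsilon> / 2"] by auto
    have "norm (?s {..<m} - ?s {..<n}) < \<epsilon>" if "N \<le> m" "N \<le> n" for m n
    proof -
      have "norm (?s {..<m} - ?s {..<N}) < \<epsilon> / 2" "norm (?s {..<n} - ?s {..<N}) < \<epsilon> / 2"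
        using N that by auto
      then show ?thesis using norm_triangle_ineq4[of "?s {..<m} - ?s {..<N}" "?s {..<n} - ?s {..<N}"] by simp
    qed
    then show "\<exists>N. \<forall>m\<ge>N. \<forall>n\<ge>N. norm (?s {..<m} - ?s {..<n}) < \<epsilon>" by blast
  qed
  then obtain h where h: "(\<lambda>n. ?s {..<n}) \<longlonglongrightarrow> h" by (meson Cauchy_convergent convergent_def)
  have "((\<lambda>n. x n *\<^sub>R e n) has_sum h) UNIV"
    unfolding has_sum_def
  proof (rule tendstoI)
    fix \<epsilon> :: real assume \<epsilon>: "0 < \<epsilon>"
    then obtain N where N: "\<And>S. finite S \<Longrightarrow> {..<N} \<subseteq> S \<Longrightarrow> norm (?s S - ?s {..<N}) < \<epsilon> / 3"
      using near[of "\<epsilon> / 3"] by auto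
    have "(\<lambda>n. norm (?s {..<n} - ?s {..<N})) \<longlonglongrightarrow> norm (h - ?s {..<N})"
      by (intro tendsto_norm tendsto_diff h tendsto_const)
    then have hN: "norm (h - ?s {..<N}) \<le> \<epsilon> / 3"
    proof (rule tendsto_upperbound)
      show "eventually (\<lambda>n. norm (?s {..<n} - ?s {..<N}) \<le> \<epsilon> / 3) sequentially"
        using N[of "{..<n}" for n] by (intro eventually_sequentiallyI[of N] less_imp_le) auto
    qed simp
    have "dist (?s S) h < \<epsilon>" if "finite S" "{..<N} \<subseteq> S" for S
      using norm_triangle_ineq4[of "?s S - ?s {..<N}" "h - ?s {..<N}"] N[OF that] hN \<epsilon> by (simp add: dist_norm)
    then show "eventually (\<lambda>S. dist (?s S) h < \<epsilon>) (finite_subsets_at_top UNIV)"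
      unfolding eventually_finite_subsets_at_top by (intro exI[of _ "{..<N}"]) auto
  qed
  then show ?thesis by (auto simp: summable_on_def)
qed

lemma norm_orthonormal_series_le:
  fixes e :: "nat \<Rightarrow> 'h::real_inner"
  assumes e: "\<And>m n. e m \<bullet> e n = (if m = n then 1 else 0)"
    and h: "((\<lambda>n. x n *\<^sub>R e n) has_sum h) UNIV"
    and C: "0 \<le> C" "\<And>S. finite S \<Longrightarrow> (\<Sum>n\<in>S. (x n)\<^sup>2) \<le> C\<^sup>2"
  shows "norm h \<le> C"
proof (rule tendsto_upperbound)
  show "((\<lambda>S. norm (\<Sum>n\<in>S. x n *\<^sub>R e n)) \<longlongrightarrow> norm h) (finite_subsets_at_top UNIV)"
    using h by (intro tendsto_norm) (simp add: has_sum_def)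
  show "eventually (\<lambda>S. norm (\<Sum>n\<in>S. x n *\<^sub>R e n) \<le> C) (finite_subsets_at_top UNIV)"
  proof (rule eventually_finite_subsets_at_top_weakI)
    fix S :: "nat set" assume S: "finite S"
    have "(norm (\<Sum>n\<in>S. x n *\<^sub>R e n))\<^sup>2 \<le> C\<^sup>2"
      unfolding norm_sum_orthonormal[OF e S] by (rule C(2)[OF S])
    then show "norm (\<Sum>n\<in>S. x n *\<^sub>R e n) \<le> C" using C(1) by (rule power2_le_imp_le)
  qed
qed simp

text \<open>This operator will be the derivative of the perturbation along H. Bounded coefficients
  and Bessel's inequality give both convergence at every h and the operator bound C.\<close>

lemma bounded_linear_diagonal:
  fixes e :: "nat \<Rightarrow> 'h::{real_inner, complete_space}"
  assumes e: "\<And>m n. e m \<bullet> e n = (if m = n then 1 else 0)" and a: "\<And>n. \<bar>a n\<bar> \<le> C"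
  shows "((\<lambda>n. (a n * (e n \<bullet> h)) *\<^sub>R e n) has_sum (\<Sum>\<^sub>\<infinity>n. (a n * (e n \<bullet> h)) *\<^sub>R e n)) UNIV"
    and "bounded_linear (\<lambda>h. \<Sum>\<^sub>\<infinity>n. (a n * (e n \<bullet> h)) *\<^sub>R e n)"
proof -
  let ?L = "\<lambda>h. \<Sum>\<^sub>\<infinity>n. (a n * (e n \<bullet> h)) *\<^sub>R e n"
  have C0: "0 \<le> C" using a[of 0] by simp
  have b: "(a n * (e n \<bullet> h))\<^sup>2 \<le> C\<^sup>2 * (e n \<bullet> h)\<^sup>2" for n h
    unfolding power_mult_distrib using power_mono[OF a[of n], of 2] by (intro mult_right_mono) auto
  have s: "summable (\<lambda>n. (a n * (e n \<bullet> h))\<^sup>2)" for h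
    by (rule summable_comparison_test'[where N = 0 and g = "\<lambda>n. C\<^sup>2 * (e n \<bullet> h)\<^sup>2"])
      (use b in \<open>auto intro: summable_mult summable_Bessel[OF e]\<close>)
  show hs: "((\<lambda>n. (a n * (e n \<bullet> h)) *\<^sub>R e n) has_sum ?L h) UNIV" for h
    using orthonormal_series_summable_on[OF e s] by (rule has_sum_infsum)
  show "bounded_linear ?L"
  proof (rule bounded_linear_intro)
    fix h k :: 'h and r :: real
    have "((\<lambda>n. (a n * (e n \<bullet> h)) *\<^sub>R e n + (a n * (e n \<bullet> k)) *\<^sub>R e n) has_sum (?L h + ?L k)) UNIV"
      by (intro has_sum_add hs)
    then have "((\<lambda>n. (a n * (e n \<bullet> (h + k))) *\<^sub>R e n) has_sum (?L h + ?L k)) UNIV"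
      by (simp add: inner_add_right distrib_left scaleR_add_left)
    then show "?L (h + k) = ?L h + ?L k" by (rule infsumI)
    have "((\<lambda>n. r *\<^sub>R ((a n * (e n \<bullet> h)) *\<^sub>R e n)) has_sum (r *\<^sub>R ?L h)) UNIV"
      by (intro has_sum_bounded_linear[OF bounded_linear_scaleR_right] hs)
    then have "((\<lambda>n. (a n * (e n \<bullet> (r *\<^sub>R h))) *\<^sub>R e n) has_sum (r *\<^sub>R ?L h)) UNIV"
      by (simp add: mult_ac)
    then show "?L (r *\<^sub>R h) = r *\<^sub>R ?L h" by (rule infsumI)
    show "norm (?L h) \<le> norm h * C"
    proof (rule norm_orthonormal_series_le[OF e hs])
      fix S :: "nat set" assume S: "finite S"
      have "(\<Sum>n\<in>S. (a n * (e n \<bullet> h))\<^sup>2) \<le> C\<^sup>2 * (\<Sum>n\<in>S. (e n \<bullet> h)\<^sup>2)"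
        unfolding sum_distrib_left by (intro sum_mono b)
      also have "\<dots> \<le> C\<^sup>2 * (norm h)\<^sup>2" by (intro mult_left_mono Bessel_inequality[OF e S]) simp
      finally show "(\<Sum>n\<in>S. (a n * (e n \<bullet> h))\<^sup>2) \<le> (norm h * C)\<^sup>2" by (simp add: power_mult_distrib mult_ac)
    qed (simp add: C0)
  qed
qed

text \<open>Values in \<open>ennreal\<close> give the sum a meaning for every sequence, so that
  divergence becomes the level set at infinity.\<close>

definition square_sum :: "(nat \<Rightarrow> real) \<Rightarrow> ennreal" where
  "square_sum x = (\<Sum>n. ennreal ((x n)\<^sup>2))"

lemma square_sum_eq: "summable (\<lambda>n. (x n)\<^sup>2) \<Longrightarrow> square_sum x = ennreal (\<Sum>n. (x n)\<^sup>2)"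
  unfolding square_sum_def by (rule suminf_ennreal2) simp

lemma square_sum_finite_iff: "square_sum x \<noteq> \<top> \<longleftrightarrow> summable (\<lambda>n. (x n)\<^sup>2)"
proof
  assume "square_sum x \<noteq> \<top>"
  then show "summable (\<lambda>n. (x n)\<^sup>2)" unfolding square_sum_def by (rule summable_suminf_not_top[rotated]) simp
next
  assume "summable (\<lambda>n. (x n)\<^sup>2)"
  then show "square_sum x \<noteq> \<top>" by (simp only: square_sum_eq ennreal_neq_top not_False_eq_True)
qed

text \<open>Partial sums increase, so exceeding r is witnessed by finitely many terms. For
  continuous terms this makes superlevel sets open, as the definition of capacity requires.\<close>

lemma square_sum_greater_iff: "ennreal r < square_sum x \<longleftrightarrow> (\<exists>N. r < (\<Sum>n<N. (x n)\<^sup>2))" if "0 \<le> r"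
proof -
  have "square_sum x = (SUP N. ennreal (\<Sum>n<N. (x n)\<^sup>2))"
    unfolding square_sum_def by (subst suminf_eq_SUP) (simp add: sum_ennreal)
  then show ?thesis using that by (simp add: less_SUP_iff ennreal_less_iff)
qed

lemma summable_square_add:
  fixes x y :: "nat \<Rightarrow> real"
  assumes "summable (\<lambda>n. (x n)\<^sup>2)" "summable (\<lambda>n. (y n)\<^sup>2)"
  shows "summable (\<lambda>n. (x n + y n)\<^sup>2)"
proof (rule summable_comparison_test'[where N = 0 and g = "\<lambda>n. 2 * (x n)\<^sup>2 + 2 * (y n)\<^sup>2"])
  show "summable (\<lambda>n. 2 * (x n)\<^sup>2 + 2 * (y n)\<^sup>2)" using assms by (intro summable_add summable_mult)
  fix n
  have "(x n + y n)\<^sup>2 \<le> 2 * (x n)\<^sup>2 + 2 * (y n)\<^sup>2"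
    using zero_le_power2[of "x n - y n"] by (simp add: power2_eq_square algebra_simps)
  then show "norm ((x n + y n)\<^sup>2) \<le> 2 * (x n)\<^sup>2 + 2 * (y n)\<^sup>2" by simp
qed

section \<open>Gaussian sequences\<close>

text \<open>Jensen's inequality with weights c n / C, where C is the total weight, cleared of
  denominators; for even k the power is convex on the whole line. It reduces moments of a weighted
  sum to moments of single terms.\<close>

lemma power_sum_le:
  fixes c y :: "nat \<Rightarrow> real"
  assumes c: "\<And>n. 0 \<le> c n" and S: "finite S" and k: "even k" "0 < k"
  shows "(\<Sum>n\<in>S. c n * y n) ^ k \<le> (\<Sum>n\<in>S. c n) ^ (k - 1) * (\<Sum>n\<in>S. c n * y n ^ k)"
proof (cases "(\<Sum>n\<in>S. c n) = 0")
  case True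
  then have "\<And>n. n \<in> S \<Longrightarrow> c n = 0" using c S by (simp add: sum_nonneg_eq_0_iff)
  then show ?thesis using k by (simp add: power_0_left)
next
  case False
  define C where "C = (\<Sum>n\<in>S. c n)"
  have C: "0 < C" using False c by (simp add: C_def less_le sum_nonneg)
  have "(\<Sum>n\<in>S. (c n / C) *\<^sub>R y n) ^ k \<le> (\<Sum>n\<in>S. (c n / C) * y n ^ k)"
    by (rule convex_on_sum[OF S _ convex_power_even[OF k(1)]])
      (use False C c in \<open>auto simp: C_def sum_divide_distrib[symmetric]\<close>)
  then have "((\<Sum>n\<in>S. c n * y n) / C) ^ k \<le> (\<Sum>n\<in>S. c n * y n ^ k) / C"
    by (simp add: sum_divide_distrib)
  then have "((\<Sum>n\<in>S. c n * y n) / C) ^ k * C ^ k \<le> (\<Sum>n\<in>S. c n * y n ^ k) / C * C ^ k"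
    using C by (intro mult_right_mono) auto
  moreover have "C ^ k = C ^ (k - 1) * C" using k by (metis Suc_pred' power_Suc2)
  ultimately show ?thesis using C by (simp add: power_divide C_def[symmetric] mult_ac)
qed

text \<open>Only the law of each single variable is prescribed; the estimates below use means,
  second moments and, through convexity, higher moments of single variables.\<close>

locale standard_normal_sequence = prob_space M for M :: "'w measure" +
  fixes \<xi> :: "nat \<Rightarrow> 'w \<Rightarrow> real"
  assumes measurable_xi [measurable]: "\<xi> n \<in> borel_measurable M"
    and law: "distr M borel (\<xi> n) = std_normal_distribution"
begin

lemma integrable_power: "integrable M (\<lambda>w. \<xi> n w ^ k)"
proof -
  have "integrable (distr M borel (\<xi> n)) (\<lambda>x. x ^ k)"
    unfolding law by (rule integrable_std_normal_distribution_moment)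
  then show ?thesis by (simp add: integrable_distr_eq)
qed

lemma expectation_power: "expectation (\<lambda>w. \<xi> n w ^ k) = (\<integral>x. x ^ k \<partial>std_normal_distribution)"
  unfolding law[of n, symmetric] by (subst integral_distr) auto

lemma expectation_xi: "integrable M (\<xi> n)" "expectation (\<xi> n) = 0"
  using integrable_power[of n 1] expectation_power[of n 1] integral_std_normal_distribution_moment_odd[of 1] by auto

lemma expectation_xi_square: "integrable M (\<lambda>w. (\<xi> n w)\<^sup>2)" "expectation (\<lambda>w. (\<xi> n w)\<^sup>2) = 1"
  using integrable_power[of n 2] expectation_power[of n 2] std_normal_distribution_even_moments(1)[of 1] by auto

text \<open>The mixed terms vanish because each variable is centred. The shift x is there for
  Mehler's formula, where the fixed point w contributes a deterministic sequence.\<close>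

lemma nn_integral_square_sum:
  assumes a: "summable (\<lambda>n. (a n)\<^sup>2)" and x: "summable (\<lambda>n. (x n)\<^sup>2)"
  shows "(\<integral>\<^sup>+w. square_sum (\<lambda>n. x n + a n * \<xi> n w) \<partial>M) = ennreal ((\<Sum>n. (x n)\<^sup>2) + (\<Sum>n. (a n)\<^sup>2))"
proof -
  have e: "(\<integral>\<^sup>+w. ennreal ((x n + a n * \<xi> n w)\<^sup>2) \<partial>M) = ennreal ((x n)\<^sup>2 + (a n)\<^sup>2)" for n
  proof -
    have eq: "(x n + a n * \<xi> n w)\<^sup>2 = (x n)\<^sup>2 + 2 * x n * a n * \<xi> n w + (a n)\<^sup>2 * (\<xi> n w)\<^sup>2" for w
      by (simp add: power2_eq_square algebra_simps)
    have i: "integrable M (\<lambda>w. (x n + a n * \<xi> n w)\<^sup>2)"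
      unfolding eq using expectation_xi expectation_xi_square by simp
    have "expectation (\<lambda>w. (x n + a n * \<xi> n w)\<^sup>2) = (x n)\<^sup>2 + (a n)\<^sup>2"
      unfolding eq using expectation_xi expectation_xi_square by (simp add: prob_space)
    then show ?thesis using nn_integral_eq_integral[OF i] by simp
  qed
  have s: "summable (\<lambda>n. (x n)\<^sup>2 + (a n)\<^sup>2)" using a x by (rule summable_add[rotated])
  have "(\<integral>\<^sup>+w. square_sum (\<lambda>n. x n + a n * \<xi> n w) \<partial>M) = (\<Sum>n. ennreal ((x n)\<^sup>2 + (a n)\<^sup>2))"
    unfolding square_sum_def by (subst nn_integral_suminf) (auto simp: e)
  also have "\<dots> = ennreal (\<Sum>n. (x n)\<^sup>2 + (a n)\<^sup>2)" by (rule suminf_ennreal2) (use s in auto)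
  also have "(\<Sum>n. (x n)\<^sup>2 + (a n)\<^sup>2) = (\<Sum>n. (x n)\<^sup>2) + (\<Sum>n. (a n)\<^sup>2)"
    using a x by (rule suminf_add[symmetric, rotated])
  finally show ?thesis .
qed

lemma measurable_square_sum [measurable]:
  "(\<lambda>w. square_sum (\<lambda>n. x n + a n * \<xi> n w)) \<in> borel_measurable M"
  unfolding square_sum_def by measurable

lemma AE_square_sum_finite:
  assumes a: "summable (\<lambda>n. (a n)\<^sup>2)" and x: "summable (\<lambda>n. (x n)\<^sup>2)"
  shows "AE w in M. square_sum (\<lambda>n. x n + a n * \<xi> n w) \<noteq> \<infinity>"
  by (rule nn_integral_PInf_AE) (auto simp: nn_integral_square_sum[OF a x])

lemma integral_square_sum:
  assumes a: "summable (\<lambda>n. (a n)\<^sup>2)" and x: "summable (\<lambda>n. (x n)\<^sup>2)"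
  shows "(\<integral>w. enn2real (square_sum (\<lambda>n. x n + a n * \<xi> n w)) \<partial>M) = (\<Sum>n. (x n)\<^sup>2) + (\<Sum>n. (a n)\<^sup>2)"
proof -
  have "(\<integral>w. enn2real (square_sum (\<lambda>n. x n + a n * \<xi> n w)) \<partial>M)
      = enn2real (\<integral>\<^sup>+w. ennreal (enn2real (square_sum (\<lambda>n. x n + a n * \<xi> n w))) \<partial>M)"
    by (rule integral_eq_nn_integral) auto
  also have "(\<integral>\<^sup>+w. ennreal (enn2real (square_sum (\<lambda>n. x n + a n * \<xi> n w))) \<partial>M)
      = (\<integral>\<^sup>+w. square_sum (\<lambda>n. x n + a n * \<xi> n w) \<partial>M)"
    by (rule nn_integral_cong_AE) (use AE_square_sum_finite[OF a x] in eventually_elim, simp add: less_top)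
  finally show ?thesis using a x
    by (simp add: nn_integral_square_sum suminf_nonneg add_nonneg_nonneg del: ennreal_plus)
qed

text \<open>Jensen's inequality with weights \<open>(a n)\<^sup>2\<close> bounds the k-th moment of
  every partial sum by the same constant, and Fatou's lemma passes to the full sum.\<close>

lemma nn_integral_square_sum_power:
  assumes a: "summable (\<lambda>n. (a n)\<^sup>2)" and k: "even k" "0 < k"
  shows "(\<integral>\<^sup>+w. ennreal (enn2real (square_sum (\<lambda>n. a n * \<xi> n w)) ^ k) \<partial>M)
    \<le> ennreal ((\<Sum>n. (a n)\<^sup>2) ^ k * (\<integral>x. x ^ (2 * k) \<partial>std_normal_distribution))"
proof -
  define A where "A = (\<Sum>n. (a n)\<^sup>2)"
  define m where "m = (\<integral>x. x ^ (2 * k) \<partial>std_normal_distribution)"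
  have m0: "0 \<le> m" unfolding m_def by simp
  have A: "(\<Sum>n<N. (a n)\<^sup>2) \<le> A" "0 \<le> A" for N
    using a by (auto simp: A_def sum_le_suminf suminf_nonneg)
  define p where "p N w = (\<Sum>n<N. (a n * \<xi> n w)\<^sup>2)" for N w
  have pm[measurable]: "p N \<in> borel_measurable M" for N unfolding p_def by measurable
  have pi: "(\<integral>\<^sup>+w. ennreal (p N w ^ k) \<partial>M) \<le> ennreal (A ^ k * m)" for N
  proof -
    have "p N w ^ k \<le> A ^ (k - 1) * (\<Sum>n<N. (a n)\<^sup>2 * \<xi> n w ^ (2 * k))" for w
    proof -
      have "p N w ^ k = (\<Sum>n<N. (a n)\<^sup>2 * (\<xi> n w)\<^sup>2) ^ k" by (simp add: p_def power_mult_distrib)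
      also have "\<dots> \<le> (\<Sum>n<N. (a n)\<^sup>2) ^ (k - 1) * (\<Sum>n<N. (a n)\<^sup>2 * ((\<xi> n w)\<^sup>2) ^ k)"
        by (rule power_sum_le) (use k in auto)
      also have "\<dots> \<le> A ^ (k - 1) * (\<Sum>n<N. (a n)\<^sup>2 * ((\<xi> n w)\<^sup>2) ^ k)"
        using A by (intro mult_right_mono power_mono sum_nonneg) auto
      finally show ?thesis by (simp add: power_mult)
    qed
    then have "(\<integral>\<^sup>+w. ennreal (p N w ^ k) \<partial>M) \<le> (\<integral>\<^sup>+w. ennreal (A ^ (k - 1) * (\<Sum>n<N. (a n)\<^sup>2 * \<xi> n w ^ (2 * k))) \<partial>M)"
      by (intro nn_integral_mono ennreal_leI)
    also have "\<dots> = ennreal (expectation (\<lambda>w. A ^ (k - 1) * (\<Sum>n<N. (a n)\<^sup>2 * \<xi> n w ^ (2 * k))))"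
      by (rule nn_integral_eq_integral)
        (use A in \<open>auto intro!: integrable_mult_right Bochner_Integration.integrable_sum integrable_power mult_nonneg_nonneg sum_nonneg\<close>)
    also have "expectation (\<lambda>w. A ^ (k - 1) * (\<Sum>n<N. (a n)\<^sup>2 * \<xi> n w ^ (2 * k))) = A ^ (k - 1) * (\<Sum>n<N. (a n)\<^sup>2 * m)"
      by (simp add: Bochner_Integration.integral_sum integrable_power expectation_power m_def)
    also have "\<dots> \<le> A ^ (k - 1) * (A * m)"
      unfolding sum_distrib_right[symmetric] using A m0 by (intro mult_left_mono mult_right_mono) auto
    also have "\<dots> = A ^ k * m" using k by (metis Suc_pred' mult.assoc power_Suc2)
    finally show ?thesis by (simp add: ennreal_leI)
  qed
  \<comment> \<open>Where the sum is infinite, \<open>enn2real\<close> returns 0 and the inequality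
    is trivial because k is positive.\<close>
  have "ennreal (enn2real (square_sum (\<lambda>n. a n * \<xi> n w)) ^ k) \<le> liminf (\<lambda>N. ennreal (p N w ^ k))" for w
  proof (cases "square_sum (\<lambda>n. a n * \<xi> n w) = \<top>")
    case False
    then have s: "summable (\<lambda>n. (a n * \<xi> n w)\<^sup>2)" by (simp add: square_sum_finite_iff)
    then have "(\<lambda>N. p N w) \<longlonglongrightarrow> (\<Sum>n. (a n * \<xi> n w)\<^sup>2)"
      unfolding p_def by (rule summable_LIMSEQ)
    then have "(\<lambda>N. ennreal (p N w ^ k)) \<longlonglongrightarrow> ennreal ((\<Sum>n. (a n * \<xi> n w)\<^sup>2) ^ k)"
      by (intro tendsto_ennrealI tendsto_power)
    then show ?thesis using s by (simp add: lim_imp_Liminf square_sum_eq suminf_nonneg)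
  qed (use k in \<open>simp add: power_0_left\<close>)
  then have "(\<integral>\<^sup>+w. ennreal (enn2real (square_sum (\<lambda>n. a n * \<xi> n w)) ^ k) \<partial>M) \<le> (\<integral>\<^sup>+w. liminf (\<lambda>N. ennreal (p N w ^ k)) \<partial>M)"
    by (intro nn_integral_mono)
  also have "\<dots> \<le> liminf (\<lambda>N. \<integral>\<^sup>+w. ennreal (p N w ^ k) \<partial>M)" by (rule nn_integral_liminf) measurable
  also have "\<dots> \<le> limsup (\<lambda>N. \<integral>\<^sup>+w. ennreal (p N w ^ k) \<partial>M)" by (intro Liminf_le_Limsup) simp
  also have "\<dots> \<le> ennreal (A ^ k * m)" by (intro Limsup_bounded always_eventually allI pi)
  finally show ?thesis by (simp add: A_def m_def)
qed

end

text \<open>For \<open>f w = \<Sum>n. (a n * \<xi> n w)\<^sup>2\<close> Mehler's formula gives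
  \<open>P\<^sub>\<tau> f = exp (- 2 * \<tau>) * f + (1 - exp (- 2 * \<tau>)) * (\<Sum>n. (a n)\<^sup>2)\<close>; hence a multiple of \<open>f\<close> itself serves as
  potential in the capacity of the superlevel sets of \<open>f\<close>.\<close>

locale linear_normal_sequence = standard_normal_sequence \<mu> \<xi>
  for \<mu> :: "'w::frechet_space measure" and \<xi> :: "nat \<Rightarrow> 'w \<Rightarrow> real" +
  assumes linear_xi: "linear (\<xi> n)" and continuous_xi: "continuous_on UNIV (\<xi> n)"
begin

text \<open>Potentials and their energies are formed from real functions, hence
  \<open>enn2real\<close>. It returns 0 where the square sum is infinite, which for square summable
  a is a null set.\<close>

definition energy :: "(nat \<Rightarrow> real) \<Rightarrow> 'w \<Rightarrow> real" where
  "energy a w = enn2real (square_sum (\<lambda>n. a n * \<xi> n w))"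

lemma energy_measurable [measurable]: "energy a \<in> borel_measurable \<mu>"
  unfolding energy_def using measurable_square_sum[of "\<lambda>_. 0" a] by simp

lemma ornstein_uhlenbeck_energy:
  assumes a: "summable (\<lambda>n. (a n)\<^sup>2)" and w: "summable (\<lambda>n. (a n * \<xi> n w)\<^sup>2)" and \<tau>: "0 \<le> \<tau>"
  shows "ornstein_uhlenbeck \<mu> \<tau> (energy a) w
    = exp (- 2 * \<tau>) * energy a w + (1 - exp (- 2 * \<tau>)) * (\<Sum>n. (a n)\<^sup>2)"
proof -
  define \<alpha> where "\<alpha> = exp (- \<tau>)"
  define \<beta> where "\<beta> = sqrt (1 - exp (- 2 * \<tau>))"
  have ab: "\<alpha>\<^sup>2 = exp (- 2 * \<tau>)" "\<beta>\<^sup>2 = 1 - exp (- 2 * \<tau>)"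
    using \<tau> by (auto simp: \<alpha>_def \<beta>_def exp_double[symmetric])
  \<comment> \<open>By linearity the point of Mehler's formula yields a shifted sequence: w gives
    the shift, and the coefficients are scaled by \<beta>.\<close>
  have lin: "a n * \<xi> n (\<alpha> *\<^sub>R w + \<beta> *\<^sub>R y) = \<alpha> * (a n * \<xi> n w) + (\<beta> * a n) * \<xi> n y" for n y
    using linear_xi[of n] by (simp add: linear_add linear_scale algebra_simps)
  have s: "summable (\<lambda>n. (\<alpha> * (a n * \<xi> n w))\<^sup>2)" "summable (\<lambda>n. (\<beta> * a n)\<^sup>2)"
    unfolding power_mult_distrib[of \<alpha>] power_mult_distrib[of \<beta>] using a w by (auto intro: summable_mult)
  have "ornstein_uhlenbeck \<mu> \<tau> (energy a) w = (\<Sum>n. (\<alpha> * (a n * \<xi> n w))\<^sup>2) + (\<Sum>n. (\<beta> * a n)\<^sup>2)"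
    unfolding ornstein_uhlenbeck_def energy_def \<alpha>_def[symmetric] \<beta>_def[symmetric] lin
    by (rule integral_square_sum[OF s(2,1)])
  also have "\<dots> = \<alpha>\<^sup>2 * (\<Sum>n. (a n * \<xi> n w)\<^sup>2) + \<beta>\<^sup>2 * (\<Sum>n. (a n)\<^sup>2)"
    unfolding power_mult_distrib[of \<alpha>] power_mult_distrib[of \<beta>] using a w by (simp add: suminf_mult)
  also have "(\<Sum>n. (a n * \<xi> n w)\<^sup>2) = energy a w"
    using w by (simp add: energy_def square_sum_eq suminf_nonneg)
  finally show ?thesis by (simp add: ab)
qed

end

section \<open>Integrals against the Gamma kernel\<close>

lemma set_integrable_Gamma:
  assumes s: "0 < (s::real)"
  shows "set_integrable lborel {0<..} (\<lambda>\<tau>. \<tau> powr (s - 1) * exp (- \<tau>))"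
proof -
  have "(\<integral>\<^sup>+\<tau>. ennreal (\<tau> powr (s - 1) / exp \<tau>) * indicator {0..} \<tau> \<partial>lborel) = ennreal (Gamma s)"
    by (rule nn_integral_has_integral_lebesgue'[OF _ Gamma_integral_real[OF s]]) simp
  moreover have "(\<integral>\<^sup>+\<tau>. ennreal (norm (indicator {0<..} \<tau> *\<^sub>R (\<tau> powr (s - 1) * exp (- \<tau>)))) \<partial>lborel)
      \<le> (\<integral>\<^sup>+\<tau>. ennreal (\<tau> powr (s - 1) / exp \<tau>) * indicator {0..} \<tau> \<partial>lborel)"
    by (intro nn_integral_mono) (auto simp: indicator_def exp_minus divide_inverse)
  ultimately show ?thesis unfolding set_integrable_def integrable_iff_bounded
    by (auto simp: top_unique less_top intro: le_less_trans)
qed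

lemma set_integral_pos:
  fixes f :: "real \<Rightarrow> real"
  assumes f: "set_integrable lborel {0<..} f" and pos: "\<And>x. 0 < x \<Longrightarrow> 0 < f x"
  shows "0 < (LBINT x:{0<..}. f x)"
proof -
  have nn: "AE x in lborel. 0 \<le> indicator {0<..} x *\<^sub>R f x"
    using pos by (intro AE_I2) (auto simp: indicator_def less_imp_le)
  have "(LBINT x:{0<..}. f x) \<noteq> 0"
  proof
    assume "(LBINT x:{0<..}. f x) = 0"
    then have "AE x in lborel. indicator {0<..} x *\<^sub>R f x = 0"
      using integral_nonneg_eq_0_iff_AE[OF f[unfolded set_integrable_def] nn]
      by (simp add: set_lebesgue_integral_def)
    then have "AE x in lborel. x \<notin> {0<..<1::real}"
      by eventually_elim (use pos in \<open>force simp: indicator_def\<close>)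
    then have "{0<..<1::real} \<in> null_sets lborel"
      using AE_iff_null_sets[of "{0<..<1::real}" lborel] by simp
    then show False by (simp add: null_sets_def)
  qed
  moreover have "0 \<le> (LBINT x:{0<..}. f x)"
    unfolding set_lebesgue_integral_def by (rule integral_nonneg_AE[OF nn])
  ultimately show ?thesis by simp
qed

section \<open>Capacity\<close>

lemma powr_le_one_plus_power:
  fixes x p :: real
  assumes "0 \<le> x" "0 < p" "p \<le> real k" shows "x powr p \<le> 1 + x ^ k"
proof (cases "x \<le> 1")
  case True
  then have "x powr p \<le> 1" using assms by (intro powr_le1) auto
  then show ?thesis using assms by (simp add: add_increasing2)
next
  case False
  then have "x powr p \<le> x powr real k" using assms by (intro powr_mono) auto
  then show ?thesis using False by (simp add: powr_realpow)
qed

lemma bessel_potential_cmult: "bessel_potential \<mu> r (\<lambda>v. c * f v) w = c * bessel_potential \<mu> r f w"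
proof -
  have "ornstein_uhlenbeck \<mu> \<tau> (\<lambda>v. c * f v) w = c * ornstein_uhlenbeck \<mu> \<tau> f w" for \<tau>
    by (simp add: ornstein_uhlenbeck_def)
  then show ?thesis by (simp add: bessel_potential_def mult.left_commute[of _ c])
qed

text \<open>The factor exp (-3 \<tau>) combines exp (-\<tau>) from the Bessel kernel with exp (-2
  \<tau>) from Mehler's formula. For positive r the value is 3 powr (-r/2), the eigenvalue of the
  Bessel potential on the second Wiener chaos; below only its positivity matters.\<close>

definition bessel_const :: "real \<Rightarrow> real" where
  "bessel_const r = (LBINT \<tau>:{0<..}. \<tau> powr (r / 2 - 1) * exp (- 3 * \<tau>)) / Gamma (r / 2)"

lemma set_integrable_powr_exp:
  assumes "0 < (r::real)"
  shows "set_integrable lborel {0<..} (\<lambda>\<tau>. \<tau> powr (r / 2 - 1) * exp (- 3 * \<tau>))"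
proof (rule set_integrable_bound[OF set_integrable_Gamma[of "r / 2"]])
  show "AE \<tau> in lborel. \<tau> \<in> {0<..} \<longrightarrow>
      norm (\<tau> powr (r / 2 - 1) * exp (- 3 * \<tau>)) \<le> norm (\<tau> powr (r / 2 - 1) * exp (- \<tau>))"
    by (intro AE_I2) (auto simp: abs_mult intro!: mult_left_mono)
next
  show "set_borel_measurable lborel {0<..} (\<lambda>\<tau>. \<tau> powr (r / 2 - 1) * exp (- 3 * \<tau>))"
    unfolding set_borel_measurable_def by measurable
  show "0 < r / 2" using assms by simp
qed

lemma bessel_const_pos: assumes "0 < r" shows "0 < bessel_const r"
  unfolding bessel_const_def
proof (rule divide_pos_pos)
  show "0 < (LBINT \<tau>:{0<..}. \<tau> powr (r / 2 - 1) * exp (- 3 * \<tau>))"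
    by (rule set_integral_pos[OF set_integrable_powr_exp[OF assms]]) simp
  show "0 < Gamma (r / 2)" using assms by (intro Gamma_real_pos) simp
qed

context linear_normal_sequence
begin

text \<open>The summand of Mehler's formula that carries the sum of the squares of a is nonnegative
  and is dropped; what remains integrates to the constant times the energy.\<close>

lemma bessel_potential_energy_ge:
  assumes a: "summable (\<lambda>n. (a n)\<^sup>2)" and w: "summable (\<lambda>n. (a n * \<xi> n w)\<^sup>2)" and r: "0 < r"
  shows "bessel_const r * energy a w \<le> bessel_potential \<mu> r (energy a) w"
proof -
  define E where "E = energy a w"
  define A where "A = (\<Sum>n. (a n)\<^sup>2)"
  have EA: "0 \<le> E" "0 \<le> A" using a by (auto simp: E_def A_def energy_def suminf_nonneg)
  define g where "g \<tau> = \<tau> powr (r / 2 - 1) * exp (- \<tau>) * (exp (- 2 * \<tau>) * E + (1 - exp (- 2 * \<tau>)) * A)" for \<tau>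
  \<comment> \<open>Monotonicity of the Bochner integral needs the larger integrand to be
    integrable, since otherwise its integral would default to 0.\<close>
  have gi: "set_integrable lborel {0<..} g"
  proof (rule set_integrable_bound)
    show "set_integrable lborel {0<..} (\<lambda>\<tau>. (E + A) * (\<tau> powr (r / 2 - 1) * exp (- \<tau>)))"
      using set_integrable_Gamma[of "r / 2"] r by simp
    show "set_borel_measurable lborel {0<..} g" unfolding set_borel_measurable_def g_def by measurable
    show "AE \<tau> in lborel. \<tau> \<in> {0<..} \<longrightarrow> norm (g \<tau>) \<le> norm ((E + A) * (\<tau> powr (r / 2 - 1) * exp (- \<tau>)))"
    proof (intro AE_I2 impI)
      fix \<tau> :: real assume "\<tau> \<in> {0<..}"
      then have e: "0 \<le> exp (- 2 * \<tau>)" "exp (- 2 * \<tau>) \<le> 1" by auto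
      have "exp (- 2 * \<tau>) * E \<le> 1 * E" "(1 - exp (- 2 * \<tau>)) * A \<le> 1 * A"
        using e EA mult_left_le_one_le[of E "exp (- 2 * \<tau>)"] mult_left_le_one_le[of A "1 - exp (- 2 * \<tau>)"]
        by simp_all
      then have "exp (- 2 * \<tau>) * E + (1 - exp (- 2 * \<tau>)) * A \<le> E + A" by simp
      moreover have "0 \<le> exp (- 2 * \<tau>) * E + (1 - exp (- 2 * \<tau>)) * A" using e EA by auto
      ultimately show "norm (g \<tau>) \<le> norm ((E + A) * (\<tau> powr (r / 2 - 1) * exp (- \<tau>)))"
        using EA by (simp add: g_def abs_mult mult.commute[of "E + A"] mult_left_mono)
    qed
  qed
  have "E * (LBINT \<tau>:{0<..}. \<tau> powr (r / 2 - 1) * exp (- 3 * \<tau>)) = (LBINT \<tau>:{0<..}. E * (\<tau> powr (r / 2 - 1) * exp (- 3 * \<tau>)))"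
    by simp
  also have "\<dots> \<le> (LBINT \<tau>:{0<..}. g \<tau>)"
  proof (rule set_integral_mono[OF _ gi])
    show "set_integrable lborel {0<..} (\<lambda>\<tau>. E * (\<tau> powr (r / 2 - 1) * exp (- 3 * \<tau>)))"
      using set_integrable_powr_exp[OF r] by simp
    fix \<tau> :: real assume "\<tau> \<in> {0<..}"
    then have "0 \<le> (1 - exp (- 2 * \<tau>)) * A" using EA by auto
    then have "\<tau> powr (r / 2 - 1) * exp (- \<tau>) * (exp (- 2 * \<tau>) * E) \<le> g \<tau>"
      unfolding g_def by (intro mult_left_mono) auto
    moreover have "exp (- 3 * \<tau>) = exp (- \<tau>) * exp (- 2 * \<tau>)" by (simp add: exp_add[symmetric])
    ultimately show "E * (\<tau> powr (r / 2 - 1) * exp (- 3 * \<tau>)) \<le> g \<tau>" by (simp add: mult_ac)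
  qed
  also have "(LBINT \<tau>:{0<..}. g \<tau>)
      = (LBINT \<tau>:{0<..}. \<tau> powr (r / 2 - 1) * exp (- \<tau>) * ornstein_uhlenbeck \<mu> \<tau> (energy a) w)"
    by (rule set_lebesgue_integral_cong)
      (use ornstein_uhlenbeck_energy[OF a w] in \<open>auto simp: g_def E_def A_def\<close>)
  finally show ?thesis
    using Gamma_real_pos[of "r / 2"] r
    by (simp add: bessel_const_def bessel_potential_def E_def mult.commute divide_right_mono)
qed

text \<open>D must be independent of c, because c is sent to 0 with p fixed.\<close>

lemma p_energy_energy_le:
  assumes a: "summable (\<lambda>n. (a n)\<^sup>2)" and p: "1 < p"
  obtains D where "0 \<le> D" "\<And>c. 0 \<le> c \<Longrightarrow> p_energy \<mu> p (\<lambda>w. c * energy a w) \<le> ennreal (c powr p * D)"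
proof -
  \<comment> \<open>An even integer above p: evenness is required by the moment bound, and the p-th
    power is dominated by 1 plus the k-th.\<close>
  define k where "k = 2 * nat \<lceil>p\<rceil>"
  have k: "even k" "0 < k" "p \<le> real k" using p by (auto simp: k_def) linarith+
  define B where "B = (\<Sum>n. (a n)\<^sup>2) ^ k * (\<integral>x. x ^ (2 * k) \<partial>std_normal_distribution)"
  have B0: "0 \<le> B" using a by (simp add: B_def suminf_nonneg)
  have "p_energy \<mu> p (\<lambda>w. c * energy a w) \<le> ennreal (c powr p * (1 + B))" if c: "0 \<le> c" for c
  proof -
    have e0: "0 \<le> energy a w" for w by (simp add: energy_def)
    have "p_energy \<mu> p (\<lambda>w. c * energy a w) \<le> (\<integral>\<^sup>+w. ennreal (c powr p) * (1 + ennreal (energy a w ^ k)) \<partial>\<mu>)"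
      unfolding p_energy_def
    proof (rule nn_integral_mono)
      fix w
      have "\<bar>c * energy a w\<bar> powr p = c powr p * energy a w powr p"
        using c e0[of w] by (simp add: powr_mult)
      also have "\<dots> \<le> c powr p * (1 + energy a w ^ k)"
        using powr_le_one_plus_power[OF e0, of p k w] p k by (intro mult_left_mono) auto
      finally have "ennreal (\<bar>c * energy a w\<bar> powr p) \<le> ennreal (c powr p * (1 + energy a w ^ k))" by (rule ennreal_leI)
      also have "\<dots> = ennreal (c powr p) * (1 + ennreal (energy a w ^ k))"
        using e0[of w] by (simp add: ennreal_mult)
      finally show "ennreal (\<bar>c * energy a w\<bar> powr p) \<le> \<dots>" .
    qed
    also have "\<dots> = ennreal (c powr p) * (1 + (\<integral>\<^sup>+w. ennreal (energy a w ^ k) \<partial>\<mu>))"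
      by (simp add: nn_integral_cmult nn_integral_add emeasure_space_1)
    also have "\<dots> \<le> ennreal (c powr p) * (1 + ennreal B)"
      using nn_integral_square_sum_power[OF a k(1,2)]
      by (intro mult_left_mono add_left_mono) (auto simp: energy_def B_def)
    also have "\<dots> = ennreal (c powr p * (1 + B))" using B0 by (simp add: ennreal_mult)
    finally show ?thesis .
  qed
  then show ?thesis using B0 that[of "1 + B"] by simp
qed

lemma open_superlevel: assumes "0 \<le> r" shows "open {w. ennreal r < square_sum (\<lambda>n. a n * \<xi> n w)}"
proof -
  have "open {w. r < (\<Sum>n<N. (a n * \<xi> n w)\<^sup>2)}" for N
    by (intro open_Collect_less continuous_intros continuous_xi)
  then show ?thesis unfolding square_sum_greater_iff[OF assms] Collect_ex_eq by auto
qed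

text \<open>The set lies in every open superlevel set of the square sum. A small multiple c of the
  energy is admissible for a high enough level, and its cost is of order c powr p.\<close>

lemma capacity_square_sum_infinite:
  assumes a: "summable (\<lambda>n. (a n)\<^sup>2)" and p: "1 < p" and r: "0 < r"
  shows "capacity \<mu> p r {w. square_sum (\<lambda>n. a n * \<xi> n w) = \<infinity>} = 0"
proof -
  obtain D where D: "0 \<le> D" "\<And>c. 0 \<le> c \<Longrightarrow> p_energy \<mu> p (\<lambda>w. c * energy a w) \<le> ennreal (c powr p * D)"
    using p_energy_energy_le[OF a p] by metis
  have K: "0 < bessel_const r" using r by (rule bessel_const_pos)
  have bound: "capacity \<mu> p r {w. square_sum (\<lambda>n. a n * \<xi> n w) = \<infinity>} \<le> ennreal (c powr p * D)"
    if c: "0 < c" for c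
  proof -
    \<comment> \<open>The level at which \<open>bessel_const r * c * l\<close> equals 1, so that the
      potential of c times the energy exceeds 1 above it.\<close>
    define l where "l = 1 / (bessel_const r * c)"
    have l: "0 < l" using K c by (simp add: l_def)
    define G where "G = {w. ennreal l < square_sum (\<lambda>n. a n * \<xi> n w)}"
    have "capacity \<mu> p r {w. square_sum (\<lambda>n. a n * \<xi> n w) = \<infinity>} \<le> open_capacity \<mu> p r G"
      unfolding capacity_def by (rule INF_lower) (use open_superlevel l in \<open>auto simp: G_def\<close>)
    also have "\<dots> \<le> p_energy \<mu> p (\<lambda>w. c * energy a w)"
      unfolding open_capacity_def
    proof (rule INF_lower, intro CollectI conjI)
      show "(\<lambda>w. c * energy a w) \<in> borel_measurable \<mu>" by measurable
      show "p_energy \<mu> p (\<lambda>w. c * energy a w) < \<infinity>"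
        using D(2)[of c] c by (simp add: le_less_trans[OF _ ennreal_less_top])
      \<comment> \<open>Points with infinite square sum lie in G although the energy is 0 there;
        admissibility is an almost everywhere condition, so they may be discarded.\<close>
      have "AE w in \<mu>. square_sum (\<lambda>n. 0 + a n * \<xi> n w) \<noteq> \<infinity>"
        by (rule AE_square_sum_finite[OF a]) simp
      then show "AE w in \<mu>. w \<in> G \<longrightarrow> 1 \<le> bessel_potential \<mu> r (\<lambda>w. c * energy a w) w"
      proof (rule eventually_mono, intro impI)
        fix w assume f: "square_sum (\<lambda>n. 0 + a n * \<xi> n w) \<noteq> \<infinity>" and "w \<in> G"
        then have "l < energy a w"
          using l by (cases "square_sum (\<lambda>n. a n * \<xi> n w)") (auto simp: G_def energy_def ennreal_less_iff)
        then have "c * (bessel_const r * l) \<le> c * (bessel_const r * energy a w)"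
          using K c by (intro mult_left_mono) auto
        also have "\<dots> \<le> c * bessel_potential \<mu> r (energy a) w"
          using bessel_potential_energy_ge[OF a _ r] f c
          by (intro mult_left_mono) (auto simp: square_sum_finite_iff)
        finally show "1 \<le> bessel_potential \<mu> r (\<lambda>w. c * energy a w) w"
          using K c by (simp add: l_def bessel_potential_cmult)
      qed
    qed
    also have "\<dots> \<le> ennreal (c powr p * D)" using D c by simp
    finally show ?thesis .
  qed
  have "(\<lambda>n. ennreal ((1 / real (Suc n)) powr p * D)) \<longlonglongrightarrow> ennreal (0 powr p * D)"
    using p by (intro tendsto_ennrealI tendsto_mult tendsto_const tendsto_powr' LIMSEQ_Suc[OF lim_const_over_n]) auto
  then have "capacity \<mu> p r {w. square_sum (\<lambda>n. a n * \<xi> n w) = \<infinity>} \<le> ennreal (0 powr p * D)"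
    by (rule LIMSEQ_le_const) (use bound in \<open>auto intro!: exI[of _ 0]\<close>)
  then show ?thesis by simp
qed

end

section \<open>Divergences as a Gaussian sequence\<close>

lemma riesz_representative_unique:
  assumes W: "wiener_space \<mu> \<iota>" and l: "riesz_representative \<iota> e l" "riesz_representative \<iota> e l'"
  shows "l = l'"
proof -
  have "closed {w. l w = l' w}"
    using l by (intro closed_Collect_eq) (auto simp: riesz_representative_def continuous_dual_def)
  moreover have "range \<iota> \<subseteq> {w. l w = l' w}" using l by (auto simp: riesz_representative_def)
  ultimately have "closure (range \<iota>) \<subseteq> {w. l w = l' w}" by (rule closure_minimal[rotated])
  then show ?thesis using W by (auto simp: wiener_space_def)
qed

lemma riesz_representative_divergence:
  assumes W: "wiener_space \<mu> \<iota>" and e: "e \<in> dual_in_H \<iota>"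
  shows "riesz_representative \<iota> e (divergence \<iota> e)"
proof -
  obtain l where l: "riesz_representative \<iota> e l" using e by (auto simp: dual_in_H_def)
  show ?thesis unfolding divergence_def
    by (rule theI[of _ l]) (use l riesz_representative_unique[OF W] in blast)+
qed

text \<open>For a unit vector the characteristic function prescribed by \<open>wiener_space\<close>
  is that of the standard normal law, and it determines the law.\<close>

lemma wiener_space_linear_normal_sequence:
  assumes W: "wiener_space \<mu> \<iota>" and e: "range e \<subseteq> dual_in_H \<iota>" and n: "\<And>n. norm (e n) = 1"
  shows "linear_normal_sequence \<mu> (\<lambda>n. divergence \<iota> (e n))"
proof -
  interpret prob_space \<mu> using W by (simp add: wiener_space_def)
  have R: "riesz_representative \<iota> (e n) (divergence \<iota> (e n))" for n
    using e by (intro riesz_representative_divergence[OF W]) auto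
  then have lc: "linear (divergence \<iota> (e n))" "continuous_on UNIV (divergence \<iota> (e n))" for n
    by (auto simp: riesz_representative_def continuous_dual_def)
  have s: "sets \<mu> = sets borel" using W by (simp add: wiener_space_def)
  have m: "divergence \<iota> (e n) \<in> borel_measurable \<mu>" for n
    using borel_measurable_continuous_onI[OF lc(2)] by (simp add: measurable_cong_sets[OF s refl])
  have "distr \<mu> borel (divergence \<iota> (e n)) = std_normal_distribution" for n
  proof (rule Levy_uniqueness[OF _ real_dist_normal_dist])
    show "real_distribution (distr \<mu> borel (divergence \<iota> (e n)))" by (rule real_distribution_distr[OF m])
    show "char (distr \<mu> borel (divergence \<iota> (e n))) = char std_normal_distribution"
    proof
      fix s
      have "char (distr \<mu> borel (divergence \<iota> (e n))) s = complex_of_real (exp (- (s * norm (e n))\<^sup>2 / 2))"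
        using W R[of n] unfolding wiener_space_def by blast
      then show "char (distr \<mu> borel (divergence \<iota> (e n))) s = char std_normal_distribution s"
        by (simp add: n char_std_normal_distribution)
    qed
  qed
  note law = this
  show ?thesis by unfold_locales (rule m law lc linear_add[OF lc(1)] linear_scale[OF lc(1)])+
qed

theorem theorem1:
  fixes P :: "'a measure"
    and F :: "real \<Rightarrow> 'a measure"
    and Z :: "real \<Rightarrow> 'a \<Rightarrow> real"
    and T :: "nat \<Rightarrow> 'a \<Rightarrow> ennreal"
    and \<mu> :: "'w::frechet_space measure"
    and \<iota> :: "'h::{real_inner, complete_space} \<Rightarrow> 'w"
    and e :: "nat \<Rightarrow> 'h"
    and t :: real
  assumes "usual_conditions P F"
    and "semimartingale P F Z"
    and "\<And>n. halfline_stopping_time F (T n)"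
    and "absorbs_jumps P Z T"
    and "wiener_space \<mu> \<iota>"
    and "orthonormal_basis e"
    and "range e \<subseteq> dual_in_H \<iota>"
    and "0 \<le> t"
  shows
    "(AE (w, z) in \<mu> \<Otimes>\<^sub>M P. \<exists>h.
        (pert_term \<iota> e Z T w z has_sum h) {n. T n z \<le> ennreal t} \<and>
        pert_map \<iota> e Z T t w z = w + \<iota> h) \<and>
     (AE z in P. \<exists>N. H_invariant \<iota> N \<and> (\<forall>p>1. \<forall>r>0. capacity \<mu> p r N = 0) \<and>
        (\<forall>w\<in>- N. (\<forall>h. pert_defined \<iota> e Z T t (w + \<iota> h) z) \<and>
                 C1_along_H \<iota> (\<lambda>v. pert \<iota> e Z T t v z) w))"
proof -
  have on: "\<And>m n. e m \<bullet> e n = (if m = n then 1 else 0)" using assms(6) by (simp add: orthonormal_basis_def)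
  define \<xi> where "\<xi> n = divergence \<iota> (e n)" for n
  interpret linear_normal_sequence \<mu> \<xi>
    unfolding \<xi>_def by (rule wiener_space_linear_normal_sequence[OF assms(5,7)]) (simp add: norm_eq_sqrt_inner on)
  interpret P: prob_space P using assms(1) by (simp add: usual_conditions_def)
  have R: "riesz_representative \<iota> (e n) (\<xi> n)" for n
    using assms(7) unfolding \<xi>_def by (intro riesz_representative_divergence[OF assms(5)]) auto
  have shift: "\<xi> n (w + \<iota> h) = \<xi> n w + e n \<bullet> h" for n w h
    using R[of n] linear_xi[of n] by (simp add: linear_add riesz_representative_def)
  have lin: "linear \<iota>" using assms(5) by (simp add: wiener_space_def)
  \<comment> \<open>Setting the coefficient to 0 when T_n > t turns the sums over a set depending on
    z into sums over all n.\<close>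
  define a where "a z n = (if T n z \<le> ennreal t then jump Z (enn2real (T n z)) z else 0)" for z n
  have term_eq: "pert_term \<iota> e Z T w z n = (a z n * \<xi> n w) *\<^sub>R e n" if "T n z \<le> ennreal t" for w z n
    using that by (simp add: pert_term_def a_def \<xi>_def)
  have hs: "(pert_term \<iota> e Z T w z has_sum h) {n. T n z \<le> ennreal t} \<longleftrightarrow>
      ((\<lambda>n. (a z n * \<xi> n w) *\<^sub>R e n) has_sum h) UNIV" for w z h
    by (rule has_sum_cong_neutral) (auto simp: term_eq, simp add: a_def)
  have pert: "pert \<iota> e Z T t w z = (\<Sum>\<^sub>\<infinity>n. (a z n * \<xi> n w) *\<^sub>R e n)" for w z
    unfolding pert_def by (rule infsum_cong_neutral) (auto simp: term_eq, simp add: a_def)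
  have a_sum: "AE z in P. summable (\<lambda>n. (a z n)\<^sup>2)"
    using semimartingale_jumps_square_summable[OF assms(1,2,8,4)]
  proof (rule eventually_mono)
    fix z assume "(\<lambda>n. (jump Z (enn2real (T n z)) z)\<^sup>2) summable_on {n. T n z \<le> ennreal t}"
    then have "(\<lambda>n. (a z n)\<^sup>2) summable_on UNIV"
      by (rule summable_on_cong_neutral[THEN iffD1, rotated -1]) (auto simp: a_def)
    then show "summable (\<lambda>n. (a z n)\<^sup>2)" by (simp add: summable_on_UNIV_nonneg_real_iff)
  qed
  have conv: "((\<lambda>n. (a z n * \<xi> n w) *\<^sub>R e n) has_sum (pert \<iota> e Z T t w z)) UNIV"
    if "square_sum (\<lambda>n. a z n * \<xi> n w) \<noteq> \<infinity>" for z w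
    unfolding pert using that
    by (intro has_sum_infsum orthonormal_series_summable_on[OF on]) (simp add: square_sum_finite_iff)
  show ?thesis
  proof
    interpret pair_sigma_finite \<mu> P ..
    have [measurable]: "(\<lambda>z. a z n) \<in> borel_measurable P" for n
      unfolding a_def using assms by (intro measurable_jump_at_stopping_time) (auto simp: semimartingale_def)
    have [measurable]: "(\<lambda>x. square_sum (\<lambda>n. a (snd x) n * \<xi> n (fst x))) \<in> borel_measurable (\<mu> \<Otimes>\<^sub>M P)"
      unfolding square_sum_def by measurable
    have "AE x in \<mu> \<Otimes>\<^sub>M P. square_sum (\<lambda>n. a (snd x) n * \<xi> n (fst x)) \<noteq> \<infinity>"
    proof (rule AE_pair_measure)
      \<comment> \<open>The Gaussian estimate holds for fixed z, whereas
        \<open>AE_pair_measure\<close> wants z inside; the exchange rests on the joint measurability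
        just shown.\<close>
      have "AE z in P. AE w in \<mu>. square_sum (\<lambda>n. a z n * \<xi> n w) \<noteq> \<infinity>"
        using a_sum
      proof (rule eventually_mono)
        fix z assume "summable (\<lambda>n. (a z n)\<^sup>2)"
        from AE_square_sum_finite[OF this, of "\<lambda>_. 0"]
        show "AE w in \<mu>. square_sum (\<lambda>n. a z n * \<xi> n w) \<noteq> \<infinity>" by simp
      qed
      then show "AE w in \<mu>. AE z in P. square_sum (\<lambda>n. a (snd (w, z)) n * \<xi> n (fst (w, z))) \<noteq> \<infinity>"
        by (subst AE_commute) (auto, measurable)
    qed measurable
    then show "AE (w, z) in \<mu> \<Otimes>\<^sub>M P. \<exists>h.
        (pert_term \<iota> e Z T w z has_sum h) {n. T n z \<le> ennreal t} \<and> pert_map \<iota> e Z T t w z = w + \<iota> h"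
    proof (rule eventually_mono, clarify)
      fix w z assume "square_sum (\<lambda>n. a (snd (w, z)) n * \<xi> n (fst (w, z))) \<noteq> \<infinity>"
      then have "(pert_term \<iota> e Z T w z has_sum pert \<iota> e Z T t w z) {n. T n z \<le> ennreal t}"
        unfolding hs by (intro conv) simp
      then show "\<exists>h. (pert_term \<iota> e Z T w z has_sum h) {n. T n z \<le> ennreal t} \<and>
          pert_map \<iota> e Z T t w z = w + \<iota> h"
        unfolding pert_map_def by blast
    qed
    show "AE z in P. \<exists>N. H_invariant \<iota> N \<and> (\<forall>p>1. \<forall>r>0. capacity \<mu> p r N = 0) \<and>
        (\<forall>w\<in>- N. (\<forall>h. pert_defined \<iota> e Z T t (w + \<iota> h) z) \<and> C1_along_H \<iota> (\<lambda>v. pert \<iota> e Z T t v z) w)"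
      using a_sum
    proof (rule eventually_mono)
      fix z assume sz: "summable (\<lambda>n. (a z n)\<^sup>2)"
      \<comment> \<open>The set depends on z but not on p or r, so one set serves all
        capacities.\<close>
      define N where "N = {w. square_sum (\<lambda>n. a z n * \<xi> n w) = \<infinity>}"
      have "Bseq (a z)"
      proof -
        have "(\<lambda>n. sqrt ((a z n)\<^sup>2)) \<longlonglongrightarrow> sqrt 0" by (intro tendsto_real_sqrt summable_LIMSEQ_zero sz)
        then have "a z \<longlonglongrightarrow> 0" by (simp add: tendsto_rabs_zero_iff)
        then show ?thesis by (intro convergent_imp_Bseq) (auto simp: convergent_def)
      qed
      then obtain C where C: "\<And>n. \<bar>a z n\<bar> \<le> C" by (auto simp: Bseq_def)
      note diag = bounded_linear_diagonal[OF on C]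
      \<comment> \<open>A shift by h changes the n-th coefficient by
        \<open>a z n * (e n \<bullet> h)\<close>, a square summable sequence because a is bounded
        and Bessel's inequality holds.\<close>
      have notN: "w + \<iota> h \<notin> N" if "w \<notin> N" for w h
      proof -
        have "summable (\<lambda>n. (a z n * \<xi> n w)\<^sup>2)" using that by (simp add: N_def square_sum_finite_iff)
        moreover have "summable (\<lambda>n. (a z n * (e n \<bullet> h))\<^sup>2)"
        proof (rule summable_comparison_test'[where N = 0 and g = "\<lambda>n. C\<^sup>2 * (e n \<bullet> h)\<^sup>2"])
          show "summable (\<lambda>n. C\<^sup>2 * (e n \<bullet> h)\<^sup>2)" by (intro summable_mult summable_Bessel[OF on])
          show "norm ((a z n * (e n \<bullet> h))\<^sup>2) \<le> C\<^sup>2 * (e n \<bullet> h)\<^sup>2" for n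
            unfolding power_mult_distrib using power_mono[OF C[of n], of 2] by (auto intro!: mult_right_mono)
        qed
        ultimately have "summable (\<lambda>n. (a z n * \<xi> n w + a z n * (e n \<bullet> h))\<^sup>2)" by (rule summable_square_add)
        then show ?thesis by (simp add: N_def square_sum_finite_iff shift distrib_left)
      qed
      show "\<exists>N. H_invariant \<iota> N \<and> (\<forall>p>1. \<forall>r>0. capacity \<mu> p r N = 0) \<and>
        (\<forall>w\<in>- N. (\<forall>h. pert_defined \<iota> e Z T t (w + \<iota> h) z) \<and> C1_along_H \<iota> (\<lambda>v. pert \<iota> e Z T t v z) w)"
      proof (intro exI[of _ N] conjI ballI allI impI)
        show "H_invariant \<iota> N"
          unfolding H_invariant_def
        proof (intro ballI allI)
          fix w h assume "w \<in> N"
          \<comment> \<open>Invariance of the complement, applied at \<open>w + \<iota> h\<close>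
            with the shift -h, returns to w.\<close>
          then show "w + \<iota> h \<in> N" using notN[of "w + \<iota> h" "- h"] lin by (auto simp: linear_neg)
        qed
        show "capacity \<mu> p r N = 0" if "1 < p" "0 < r" for p r
          unfolding N_def by (rule capacity_square_sum_infinite[OF sz that])
        fix w assume "w \<in> - N"
        then have wN: "w + \<iota> h \<notin> N" for h using notN by simp
        show "pert_defined \<iota> e Z T t (w + \<iota> h) z" for h
          using conv[of z "w + \<iota> h"] wN[of h] hs[of "w + \<iota> h" z] by (auto simp: pert_defined_def summable_on_def N_def)
        define L where "L h = (\<Sum>\<^sub>\<infinity>n. (a z n * (e n \<bullet> h)) *\<^sub>R e n)" for h
        have L: "bounded_linear L" unfolding L_def by (rule diag(2))
        have aff: "pert \<iota> e Z T t (w + \<iota> h) z = pert \<iota> e Z T t w z + L h" for h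
        proof -
          have "((\<lambda>n. (a z n * \<xi> n w) *\<^sub>R e n + (a z n * (e n \<bullet> h)) *\<^sub>R e n) has_sum (pert \<iota> e Z T t w z + L h)) UNIV"
            unfolding L_def using \<open>w \<in> - N\<close> by (intro has_sum_add conv diag(1)) (simp add: N_def)
          then have "((\<lambda>n. (a z n * \<xi> n (w + \<iota> h)) *\<^sub>R e n) has_sum (pert \<iota> e Z T t w z + L h)) UNIV"
            by (simp add: shift distrib_left scaleR_add_left)
          then show ?thesis unfolding pert[of "w + \<iota> h"] by (rule infsumI)
        qed
        show "C1_along_H \<iota> (\<lambda>v. pert \<iota> e Z T t v z) w"
          unfolding C1_along_H_def
        \<comment> \<open>The derivative is the same operator at every h, so its continuity is that
          of a constant map.\<close>
        proof (intro exI[of _ "\<lambda>_. Blinfun L"] conjI allI)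
          fix h
          have "((\<lambda>k. pert \<iota> e Z T t w z + L k) has_derivative (\<lambda>k. 0 + L k)) (at h)"
            by (intro has_derivative_add has_derivative_const bounded_linear_imp_has_derivative L)
          then show "((\<lambda>k. pert \<iota> e Z T t (w + \<iota> k) z) has_derivative blinfun_apply (Blinfun L)) (at h)"
            by (simp add: aff bounded_linear_Blinfun_apply[OF L])
        qed simp
      qed
    qed
  qed
qed

end
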